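(* Let $k$ be an algebraically closed field of characteristic $p>0$, let $L$ be an ample line bundle on a projective variety $X$ over $k$, and let $Z$ be a reduced finite set of smooth points on $X$. Then $\epsilon_F(L^r;Z)=r\cdot\epsilon_F(L;Z)$ for every positive integer $r$.
   Context: A variety is irreducible and reduced; points are closed points; $L^m$ denotes the $m$-th tensor power of $L$. For a coherent ideal $J$ on $X$ and $e\geq 1$, $J^{[p^e]}$ is the ideal locally generated by the $p^e$-th powers of local generators of $J$. Let $Z$ be a finite set of smooth closed points of $X$, with the reduced scheme structure, defined by the ideal $I_Z$. A line bundle $A$ on $X$ separates $p^e$-Frobenius jets at $Z$ if the restriction map $H^0(X,A)\to H^0(X,A\otimes\mathcal{O}_X/I_Z^{[p^e]})$ is surjective. Let $s_F(L^m;Z)$ be the largest $e\geq 1$ such that $L^m$ separates $p^e$-Frobenius jets at $Z$, with $s_F(L^m;Z)=0$ if there is no such $e$. The Frobenius-Seshadri constant of $L$ at $Z$ is $$\epsilon_F(L;Z):=\sup_{m\geq 1}\frac{p^{s_F(L^m;Z)}-1}{m}.$$ *)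

theory Defs
  imports "HOL-Analysis.Analysis" "HOL-Computational_Algebra.Computational_Algebra"
begin

text \<open>
  Varieties are treated classically: over an algebraically closed field a projective variety is an
  irreducible Zariski-closed set of closed points in some projective space, with its sheaf of
  regular functions. The ground field is a type of class \<open>alg_closed_field\<close>.
\<close>

section \<open>Projective space and its Zariski topology\<close>

text \<open>
  A point of projective \<open>n\<close>-space is the set of all its homogeneous coordinate vectors
  (a line through the origin in affine \<open>(n+1)\<close>-space, with the origin removed). Vectors are
  functions on \<open>nat\<close> that vanish beyond index \<open>n\<close>.
\<close>

type_synonym 'a pt = "(nat \<Rightarrow> 'a) set"

definition proj_pt :: "(nat \<Rightarrow> 'a::field) \<Rightarrow> 'a pt" where
  "proj_pt v = {\<lambda>i. c * v i | c. c \<noteq> 0}"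

definition proj_space :: "nat \<Rightarrow> 'a::field pt set" where
  "proj_space n = {proj_pt v | v. v \<noteq> (\<lambda>_. 0) \<and> (\<forall>i>n. v i = 0)}"

definition exponents :: "nat \<Rightarrow> nat \<Rightarrow> (nat \<Rightarrow> nat) set" where
  "exponents n d = {\<alpha>. (\<forall>i>n. \<alpha> i = 0) \<and> (\<Sum>i\<le>n. \<alpha> i) = d}"

text \<open>
  Homogeneous polynomials of degree \<open>d\<close> in \<open>n+1\<close> variables, as functions; the field is infinite,
  so nothing is lost.
\<close>

definition form :: "nat \<Rightarrow> nat \<Rightarrow> ((nat \<Rightarrow> 'a::field) \<Rightarrow> 'a) \<Rightarrow> bool" where
  "form n d F \<longleftrightarrow>
     (\<exists>c. \<forall>v. F v = (\<Sum>\<alpha>\<in>exponents n d. c \<alpha> * (\<Prod>i\<le>n. v i ^ \<alpha> i)))"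

definition nonvanishing :: "nat \<Rightarrow> ((nat \<Rightarrow> 'a::field) \<Rightarrow> 'a) set \<Rightarrow> 'a pt set" where
  "nonvanishing n S = {P \<in> proj_space n. \<exists>F\<in>S. \<exists>v\<in>P. F v \<noteq> 0}"

definition zariski_open :: "nat \<Rightarrow> 'a::field pt set \<Rightarrow> bool" where
  "zariski_open n U \<longleftrightarrow> (\<exists>S. (\<forall>F\<in>S. \<exists>d. form n d F) \<and> U = nonvanishing n S)"

definition zariski :: "nat \<Rightarrow> 'a::field pt topology" where
  "zariski n = topology (zariski_open n)"

lemma finite_exponents: "finite (exponents n d)"
proof -
  have "exponents n d \<subseteq> {\<alpha>. \<forall>i. (i \<in> {..n} \<longrightarrow> \<alpha> i \<in> {..d}) \<and> (i \<notin> {..n} \<longrightarrow> \<alpha> i = 0)}"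
  proof
    fix \<alpha> assume a: "\<alpha> \<in> exponents n d"
    have "\<alpha> i \<le> d" if "i \<le> n" for i
      using a that member_le_sum[of i "{..n}" \<alpha>] by (auto simp: exponents_def)
    with a show "\<alpha> \<in> {\<alpha>. \<forall>i. (i \<in> {..n} \<longrightarrow> \<alpha> i \<in> {..d}) \<and> (i \<notin> {..n} \<longrightarrow> \<alpha> i = 0)}"
      by (auto simp: exponents_def)
  qed
  then show ?thesis
    using finite_set_of_finite_funs[of "{..n}" "{..d}" "0::nat"] finite_subset by auto
qed

lemma form_mult:
  assumes "form n d F" "form n e G"
  shows "form n (d + e) (\<lambda>v. F v * G v)"
proof -
  obtain a where a: "\<And>v. F v = (\<Sum>\<alpha>\<in>exponents n d. a \<alpha> * (\<Prod>i\<le>n. v i ^ \<alpha> i))"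
    using assms(1) by (auto simp: form_def)
  obtain b where b: "\<And>v. G v = (\<Sum>\<alpha>\<in>exponents n e. b \<alpha> * (\<Prod>i\<le>n. v i ^ \<alpha> i))"
    using assms(2) by (auto simp: form_def)
  let ?A = "exponents n d \<times> exponents n e"
  let ?s = "\<lambda>(\<alpha>::nat\<Rightarrow>nat, \<beta>::nat\<Rightarrow>nat). (\<lambda>i. \<alpha> i + \<beta> i)"
  define c where "c \<gamma> = (\<Sum>x\<in>{x\<in>?A. ?s x = \<gamma>}. a (fst x) * b (snd x))" for \<gamma>
  have im: "?s ` ?A \<subseteq> exponents n (d + e)"
    by (auto simp: exponents_def sum.distrib)
  have "F v * G v = (\<Sum>\<gamma>\<in>exponents n (d + e). c \<gamma> * (\<Prod>i\<le>n. v i ^ \<gamma> i))" for v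
  proof -
    have "F v * G v = (\<Sum>x\<in>?A. a (fst x) * b (snd x) * (\<Prod>i\<le>n. v i ^ (?s x) i))"
      unfolding a b sum_product sum.cartesian_product
      by (intro sum.cong) (auto simp: power_add prod.distrib mult_ac)
    also have "\<dots> = (\<Sum>\<gamma>\<in>exponents n (d + e). \<Sum>x\<in>{x\<in>?A. ?s x = \<gamma>}.
                      a (fst x) * b (snd x) * (\<Prod>i\<le>n. v i ^ (?s x) i))"
      using finite_exponents im by (intro sum.group[symmetric]) auto
    also have "\<dots> = (\<Sum>\<gamma>\<in>exponents n (d + e). c \<gamma> * (\<Prod>i\<le>n. v i ^ \<gamma> i))"
      unfolding c_def sum_distrib_right by (intro sum.cong refl) auto
    finally show ?thesis .
  qed
  then show ?thesis unfolding form_def by blast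
qed

lemma form_scale:
  assumes "form n d F"
  shows "F (\<lambda>i. c * v i) = c ^ d * F v"
proof -
  obtain a where a: "\<And>v. F v = (\<Sum>\<alpha>\<in>exponents n d. a \<alpha> * (\<Prod>i\<le>n. v i ^ \<alpha> i))"
    using assms by (auto simp: form_def)
  have "(\<Prod>i\<le>n. (c * v i) ^ \<alpha> i) = c ^ d * (\<Prod>i\<le>n. v i ^ \<alpha> i)" if "\<alpha> \<in> exponents n d" for \<alpha>
    using that by (auto simp: exponents_def power_mult_distrib prod.distrib power_sum)
  then show ?thesis
    unfolding a by (auto simp: sum_distrib_left mult_ac intro!: sum.cong)
qed

lemma nonvanishing_at:
  assumes "form n d F" "P \<in> proj_space n" "v \<in> P" "w \<in> P" "F v \<noteq> 0"
  shows "F w \<noteq> 0"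
  using assms by (auto simp: proj_space_def proj_pt_def form_scale)

lemma istopology_zariski_open: "istopology (zariski_open n)"
  unfolding istopology_def
proof (intro conjI allI impI)
  fix U V :: "'a pt set" assume "zariski_open n U" "zariski_open n V"
  then obtain S T where S: "\<forall>F\<in>S. \<exists>d. form n d F" "U = nonvanishing n S"
    and T: "\<forall>F\<in>T. \<exists>d. form n d F" "V = nonvanishing n T"
    by (auto simp: zariski_open_def)
  let ?R = "{\<lambda>v. F v * G v | F G. F \<in> S \<and> G \<in> T}"
  have 1: "\<forall>H\<in>?R. \<exists>d. form n d H"
    using S(1) T(1) form_mult by blast
  have 2: "U \<inter> V = nonvanishing n ?R"
  proof (intro equalityI subsetI)
    fix P assume "P \<in> U \<inter> V"
    then obtain F G v w where *: "P \<in> proj_space n" "F \<in> S" "G \<in> T" "v \<in> P" "w \<in> P"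
      "F v \<noteq> 0" "G w \<noteq> 0" using S T by (auto simp: nonvanishing_def)
    obtain e where "form n e G" using * T(1) by blast
    then have "G v \<noteq> 0" using * nonvanishing_at by blast
    with * have "\<exists>v\<in>P. F v * G v \<noteq> 0" by auto
    moreover have "(\<lambda>v. F v * G v) \<in> ?R"
      using *(2,3) by (intro CollectI exI[of _ F] exI[of _ G] conjI) auto
    ultimately have "\<exists>H\<in>?R. \<exists>v\<in>P. H v \<noteq> 0" by (rule bexI)
    with *(1) show "P \<in> nonvanishing n ?R" by (simp only: nonvanishing_def mem_Collect_eq simp_thms)
  next
    fix P assume "P \<in> nonvanishing n ?R"
    then obtain F G v where "P \<in> proj_space n" "F \<in> S" "G \<in> T" "v \<in> P" "F v * G v \<noteq> 0"
      by (auto simp: nonvanishing_def)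
    then show "P \<in> U \<inter> V" unfolding S(2) T(2) nonvanishing_def by auto
  qed
  from 1 2 show "zariski_open n (U \<inter> V)" unfolding zariski_open_def by blast
next
  fix \<U> :: "'a pt set set" assume "\<forall>U\<in>\<U>. zariski_open n U"
  then obtain S where S: "\<And>U. U \<in> \<U> \<Longrightarrow> (\<forall>F\<in>S U. \<exists>d. form n d F) \<and> U = nonvanishing n (S U)"
    unfolding zariski_open_def by metis
  have "\<Union>\<U> = nonvanishing n (\<Union>U\<in>\<U>. S U)"
  proof (intro equalityI subsetI)
    fix P assume "P \<in> \<Union>\<U>"
    then obtain U where "U \<in> \<U>" "P \<in> nonvanishing n (S U)" using S by blast
    then show "P \<in> nonvanishing n (\<Union>U\<in>\<U>. S U)" by (auto simp: nonvanishing_def)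
  next
    fix P assume "P \<in> nonvanishing n (\<Union>U\<in>\<U>. S U)"
    then obtain U where "U \<in> \<U>" "P \<in> nonvanishing n (S U)" by (auto simp: nonvanishing_def)
    then show "P \<in> \<Union>\<U>" using S by blast
  qed
  moreover have "\<forall>F\<in>(\<Union>U\<in>\<U>. S U). \<exists>d. form n d F"
  proof
    fix F assume "F \<in> (\<Union>U\<in>\<U>. S U)"
    then obtain U where "U \<in> \<U>" "F \<in> S U" by blast
    then show "\<exists>d. form n d F" using conjunct1[OF S[of U]] by blast
  qed
  ultimately show "zariski_open n (\<Union>\<U>)"
    unfolding zariski_open_def by (intro exI conjI)
qed

lemma openin_zariski: "openin (zariski n) U \<longleftrightarrow> zariski_open n U"
  unfolding zariski_def by (simp add: topology_inverse' istopology_zariski_open)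

lemma topspace_zariski: "topspace (zariski n :: 'a::field pt topology) = proj_space n"
proof
  show "topspace (zariski n :: 'a pt topology) \<subseteq> proj_space n"
    by (auto simp: topspace_def openin_zariski zariski_open_def nonvanishing_def)
  have 0: "form n 0 (\<lambda>_. 1 :: 'a)"
  proof -
    have "exponents n 0 = {\<lambda>_. 0}" by (auto simp: exponents_def fun_eq_iff) (meson atMost_iff not_le)
    then show ?thesis by (auto simp: form_def intro!: exI[of _ "\<lambda>_. 1"])
  qed
  have "nonvanishing n {\<lambda>_. 1 :: 'a} = proj_space n"
  proof -
    have "v \<in> proj_pt v" for v :: "nat \<Rightarrow> 'a"
      unfolding proj_pt_def by (intro CollectI exI[of _ 1]) simp
    then have "\<exists>v. v \<in> P" if "P \<in> proj_space n" for P :: "'a pt"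
      using that unfolding proj_space_def by blast
    then show ?thesis unfolding nonvanishing_def by auto
  qed
  with 0 have "zariski_open n (proj_space n :: 'a pt set)"
    unfolding zariski_open_def by blast
  then show "proj_space n \<subseteq> topspace (zariski n :: 'a pt topology)"
    by (simp add: openin_subset openin_zariski)
qed


section \<open>Projective varieties, regular functions, morphisms\<close>

definition irreducible_closedin :: "'b topology \<Rightarrow> 'b set \<Rightarrow> bool" where
  "irreducible_closedin T C \<longleftrightarrow> closedin T C \<and> C \<noteq> {} \<and>
     (\<forall>A B. closedin T A \<and> closedin T B \<and> C \<subseteq> A \<union> B \<longrightarrow> C \<subseteq> A \<or> C \<subseteq> B)"

definition projective_variety :: "nat \<Rightarrow> 'a::field pt set \<Rightarrow> bool" where
  "projective_variety n X \<longleftrightarrow> irreducible_closedin (zariski n) X"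

abbreviation top_of :: "nat \<Rightarrow> 'a::field pt set \<Rightarrow> 'a pt topology" where
  "top_of n X \<equiv> subtopology (zariski n) X"

text \<open>
  \<open>regular_on n X U\<close> is the ring of regular functions on the open subset \<open>U\<close> of \<open>X\<close>; only the
  values on \<open>U\<close> matter.
\<close>

definition regular_on :: "nat \<Rightarrow> 'a::field pt set \<Rightarrow> 'a pt set \<Rightarrow> ('a pt \<Rightarrow> 'a) set" where
  "regular_on n X U = {f. \<forall>P\<in>U. \<exists>W d g h. openin (top_of n X) W \<and> P \<in> W \<and> W \<subseteq> U \<and>
     form n d g \<and> form n d h \<and> (\<forall>Q\<in>W. \<forall>v\<in>Q. h v \<noteq> 0 \<and> f Q = g v / h v)}"

definition morphism ::
  "nat \<Rightarrow> 'a::field pt set \<Rightarrow> nat \<Rightarrow> 'a pt set \<Rightarrow> ('a pt \<Rightarrow> 'a pt) \<Rightarrow> bool" where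
  "morphism n X N Y \<phi> \<longleftrightarrow> continuous_map (top_of n X) (top_of N Y) \<phi> \<and>
     (\<forall>V f. openin (top_of N Y) V \<and> f \<in> regular_on N Y V \<longrightarrow>
        (\<lambda>P. f (\<phi> P)) \<in> regular_on n X {P \<in> X. \<phi> P \<in> V})"

text \<open>An isomorphism of \<open>X\<close> onto a closed subvariety of projective \<open>N\<close>-space.\<close>

definition closed_embedding ::
  "nat \<Rightarrow> 'a::field pt set \<Rightarrow> nat \<Rightarrow> ('a pt \<Rightarrow> 'a pt) \<Rightarrow> bool" where
  "closed_embedding n X N \<phi> \<longleftrightarrow> closedin (zariski N) (\<phi> ` X) \<and> morphism n X N (\<phi> ` X) \<phi> \<and>
     (\<exists>\<psi>. morphism N (\<phi> ` X) n X \<psi> \<and> (\<forall>P\<in>X. \<psi> (\<phi> P) = P))"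


section \<open>Smooth points\<close>

definition ideal_sheaf ::
  "nat \<Rightarrow> 'a::field pt set \<Rightarrow> 'a pt set \<Rightarrow> 'a pt set \<Rightarrow> ('a pt \<Rightarrow> 'a) set" where
  "ideal_sheaf n X Z W = {f \<in> regular_on n X W. \<forall>P\<in>W \<inter> Z. f P = 0}"

text \<open>The germ of \<open>f\<close> at \<open>P\<close> lies in the square of the maximal ideal of the local ring.\<close>

definition in_max_sq :: "nat \<Rightarrow> 'a::field pt set \<Rightarrow> 'a pt \<Rightarrow> ('a pt \<Rightarrow> 'a) \<Rightarrow> bool" where
  "in_max_sq n X P f \<longleftrightarrow> (\<exists>V r a b. openin (top_of n X) V \<and> P \<in> V \<and>
     (\<forall>j<r. a j \<in> ideal_sheaf n X {P} V \<and> b j \<in> ideal_sheaf n X {P} V) \<and>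
     (\<forall>Q\<in>V. f Q = (\<Sum>j<(r::nat). a j Q * b j Q)))"

text \<open>
  The germs at \<open>P\<close> of \<open>u 0, \<dots>, u (d - 1)\<close> form a basis of the cotangent space, i.e. of the
  maximal ideal modulo its square.
\<close>

definition cotangent_basis ::
  "nat \<Rightarrow> 'a::field pt set \<Rightarrow> 'a pt \<Rightarrow> nat \<Rightarrow> (nat \<Rightarrow> 'a pt \<Rightarrow> 'a) \<Rightarrow> bool" where
  "cotangent_basis n X P d u \<longleftrightarrow>
     (\<exists>U. openin (top_of n X) U \<and> P \<in> U \<and> (\<forall>i<d. u i \<in> ideal_sheaf n X {P} U)) \<and>
     (\<forall>V f. openin (top_of n X) V \<and> P \<in> V \<and> f \<in> ideal_sheaf n X {P} V \<longrightarrow>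
        (\<exists>c. in_max_sq n X P (\<lambda>Q. f Q - (\<Sum>i<d. c i * u i Q)))) \<and>
     (\<forall>c. in_max_sq n X P (\<lambda>Q. \<Sum>i<d. c i * u i Q) \<longrightarrow> (\<forall>i<d. c i = 0))"

definition variety_dim :: "nat \<Rightarrow> 'a::field pt set \<Rightarrow> enat" where
  "variety_dim n X = Sup {enat d | d. \<exists>C. (\<forall>i\<le>d. irreducible_closedin (zariski n) (C i) \<and> C i \<subseteq> X) \<and>
     (\<forall>i<d. C i \<subset> C (Suc i))}"

text \<open>
  All local rings of a variety at closed points have dimension \<open>dim X\<close>, so this says that the
  local ring at \<open>P\<close> is regular; over an algebraically closed field that is smoothness.
\<close>

definition smooth_point :: "nat \<Rightarrow> 'a::field pt set \<Rightarrow> 'a pt \<Rightarrow> bool" where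
  "smooth_point n X P \<longleftrightarrow> P \<in> X \<and> (\<exists>d u. variety_dim n X = enat d \<and> cotangent_basis n X P d u)"


section \<open>Line bundles\<close>

text \<open>
  A line bundle is given by a trivialising open cover and transition functions; a section over
  \<open>W\<close> is a family of regular functions with \<open>s\<^sub>i = g\<^sub>i\<^sub>j s\<^sub>j\<close>.
\<close>

record ('i, 'a) lbundle =
  idx :: "'i set"
  chart :: "'i \<Rightarrow> 'a pt set"
  trans_fun :: "'i \<Rightarrow> 'i \<Rightarrow> 'a pt \<Rightarrow> 'a"

definition line_bundle :: "nat \<Rightarrow> 'a::field pt set \<Rightarrow> ('i, 'a) lbundle \<Rightarrow> bool" where
  "line_bundle n X L \<longleftrightarrow>
     (\<forall>i\<in>idx L. openin (top_of n X) (chart L i)) \<and> (\<Union>i\<in>idx L. chart L i) = X \<and>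
     (\<forall>i\<in>idx L. \<forall>j\<in>idx L. trans_fun L i j \<in> regular_on n X (chart L i \<inter> chart L j) \<and>
        (\<forall>P\<in>chart L i \<inter> chart L j. trans_fun L i j P \<noteq> 0)) \<and>
     (\<forall>i\<in>idx L. \<forall>j\<in>idx L. \<forall>k\<in>idx L. \<forall>P\<in>chart L i \<inter> chart L j \<inter> chart L k.
        trans_fun L i j P * trans_fun L j k P = trans_fun L i k P)"

definition sections ::
  "nat \<Rightarrow> 'a::field pt set \<Rightarrow> ('i, 'a) lbundle \<Rightarrow> 'a pt set \<Rightarrow> ('i \<Rightarrow> 'a pt \<Rightarrow> 'a) set" where
  "sections n X L W = {s. (\<forall>i\<in>idx L. s i \<in> regular_on n X (W \<inter> chart L i)) \<and>
     (\<forall>i\<in>idx L. \<forall>j\<in>idx L. \<forall>P\<in>W \<inter> chart L i \<inter> chart L j. s i P = trans_fun L i j P * s j P)}"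

definition tensor_power :: "('i, 'a::field) lbundle \<Rightarrow> nat \<Rightarrow> ('i, 'a) lbundle" where
  "tensor_power L m = L\<lparr>trans_fun := \<lambda>i j P. trans_fun L i j P ^ m\<rparr>"

text \<open>Multiplication by the \<open>h j i\<close> takes the \<open>i\<close>-th component in \<open>L\<close> to the \<open>j\<close>-th one in \<open>M\<close>.\<close>

definition lb_iso ::
  "nat \<Rightarrow> 'a::field pt set \<Rightarrow> ('i, 'a) lbundle \<Rightarrow> ('j, 'a) lbundle \<Rightarrow> bool" where
  "lb_iso n X L M \<longleftrightarrow> (\<exists>h.
     (\<forall>i\<in>idx L. \<forall>j\<in>idx M. h j i \<in> regular_on n X (chart L i \<inter> chart M j) \<and>
        (\<forall>P\<in>chart L i \<inter> chart M j. h j i P \<noteq> 0)) \<and>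
     (\<forall>i\<in>idx L. \<forall>i'\<in>idx L. \<forall>j\<in>idx M. \<forall>j'\<in>idx M.
        \<forall>P\<in>chart L i \<inter> chart L i' \<inter> chart M j \<inter> chart M j'.
          trans_fun M j' j P * h j i P * trans_fun L i i' P = h j' i' P))"

definition pullback ::
  "'a::field pt set \<Rightarrow> ('a pt \<Rightarrow> 'a pt) \<Rightarrow> ('i, 'a) lbundle \<Rightarrow> ('i, 'a) lbundle" where
  "pullback X \<phi> M = \<lparr>idx = idx M, chart = (\<lambda>i. {P \<in> X. \<phi> P \<in> chart M i}),
     trans_fun = (\<lambda>i j P. trans_fun M i j (\<phi> P))\<rparr>"

text \<open>
  \<open>O(1)\<close>: on the \<open>i\<close>-th standard chart a linear form \<open>F\<close> has the component \<open>F / x\<^sub>i\<close>. The ratio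
  below does not depend on the chosen coordinate vector.
\<close>

definition O1 :: "nat \<Rightarrow> (nat, 'a::field) lbundle" where
  "O1 N = \<lparr>idx = {..N}, chart = (\<lambda>i. {Q \<in> proj_space N. \<exists>v\<in>Q. v i \<noteq> 0}),
     trans_fun = (\<lambda>i j Q. let v = (SOME v. v \<in> Q) in v j / v i)\<rparr>"

definition very_ample :: "nat \<Rightarrow> 'a::field pt set \<Rightarrow> ('i, 'a) lbundle \<Rightarrow> bool" where
  "very_ample n X L \<longleftrightarrow>
     (\<exists>N \<phi>. closed_embedding n X N \<phi> \<and> lb_iso n X L (pullback X \<phi> (O1 N)))"

definition ample :: "nat \<Rightarrow> 'a::field pt set \<Rightarrow> ('i, 'a) lbundle \<Rightarrow> bool" where
  "ample n X L \<longleftrightarrow> (\<exists>m\<ge>1. very_ample n X (tensor_power L m))"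


section \<open>Frobenius jets and the Frobenius-Seshadri constant\<close>

text \<open>
  For an ideal sheaf \<open>J\<close> (sections over each open set), the ideal sheaf locally generated by
  \<open>q\<close>-th powers of sections of \<open>J\<close>. For \<open>q\<close> a power of the characteristic the \<open>q\<close>-th powers of
  any local generators generate the same ideal.
\<close>

definition frob_power ::
  "nat \<Rightarrow> 'a::field pt set \<Rightarrow> ('a pt set \<Rightarrow> ('a pt \<Rightarrow> 'a) set) \<Rightarrow> nat \<Rightarrow>
   'a pt set \<Rightarrow> ('a pt \<Rightarrow> 'a) set" where
  "frob_power n X J q W = {f \<in> regular_on n X W. \<forall>P\<in>W.
     \<exists>V r a g. openin (top_of n X) V \<and> P \<in> V \<and> V \<subseteq> W \<and>
       (\<forall>j<r. a j \<in> regular_on n X V \<and> g j \<in> J V) \<and>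
       (\<forall>Q\<in>V. f Q = (\<Sum>j<(r::nat). a j Q * g j Q ^ q))}"

text \<open>The sections over \<open>W\<close> of the subsheaf \<open>J A\<close> of the line bundle \<open>A\<close>.\<close>

definition ideal_sections ::
  "nat \<Rightarrow> 'a::field pt set \<Rightarrow> ('i, 'a) lbundle \<Rightarrow> ('a pt set \<Rightarrow> ('a pt \<Rightarrow> 'a) set) \<Rightarrow>
   'a pt set \<Rightarrow> ('i \<Rightarrow> 'a pt \<Rightarrow> 'a) set" where
  "ideal_sections n X A J W = {s \<in> sections n X A W. \<forall>i\<in>idx A. s i \<in> J (W \<inter> chart A i)}"

text \<open>
  A global section of the quotient sheaf \<open>A / J A\<close>, that is, of \<open>A\<close> tensored with the structure
  sheaf modulo \<open>J\<close>, is represented by sections of \<open>A\<close> on the members of an open cover that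
  agree modulo \<open>J A\<close> on overlaps.
\<close>

definition quotient_section ::
  "nat \<Rightarrow> 'a::field pt set \<Rightarrow> ('i, 'a) lbundle \<Rightarrow> ('a pt set \<Rightarrow> ('a pt \<Rightarrow> 'a) set) \<Rightarrow>
   ('a pt set \<times> ('i \<Rightarrow> 'a pt \<Rightarrow> 'a)) set \<Rightarrow> bool" where
  "quotient_section n X A J T \<longleftrightarrow>
     (\<forall>(W, t)\<in>T. openin (top_of n X) W \<and> t \<in> sections n X A W) \<and> (\<Union>(W, t)\<in>T. W) = X \<and>
     (\<forall>(W, t)\<in>T. \<forall>(W', t')\<in>T.
        (\<lambda>i P. t i P - t' i P) \<in> ideal_sections n X A J (W \<inter> W'))"

definition restricts_to ::
  "nat \<Rightarrow> 'a::field pt set \<Rightarrow> ('i, 'a) lbundle \<Rightarrow> ('a pt set \<Rightarrow> ('a pt \<Rightarrow> 'a) set) \<Rightarrow>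
   ('i \<Rightarrow> 'a pt \<Rightarrow> 'a) \<Rightarrow> ('a pt set \<times> ('i \<Rightarrow> 'a pt \<Rightarrow> 'a)) set \<Rightarrow> bool" where
  "restricts_to n X A J s T \<longleftrightarrow>
     (\<forall>(W, t)\<in>T. (\<lambda>i P. s i P - t i P) \<in> ideal_sections n X A J W)"

definition separates_frobenius_jets ::
  "nat \<Rightarrow> 'a::field pt set \<Rightarrow> ('i, 'a) lbundle \<Rightarrow> 'a pt set \<Rightarrow> nat \<Rightarrow> bool" where
  "separates_frobenius_jets n X A Z e \<longleftrightarrow>
     (let J = frob_power n X (ideal_sheaf n X Z) (CHAR('a) ^ e) in
      \<forall>T. quotient_section n X A J T \<longrightarrow> (\<exists>s\<in>sections n X A X. restricts_to n X A J s T))"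

text \<open>
  The supremum in \<open>enat\<close> is the largest element of a nonempty finite set, \<open>0\<close> for the empty set,
  and \<open>\<infinity>\<close> for an infinite set. The last case arises only in the degenerate situations where
  \<open>Z\<close> is empty or \<open>X\<close> is a point.
\<close>

definition s_F :: "nat \<Rightarrow> 'a::field pt set \<Rightarrow> ('i, 'a) lbundle \<Rightarrow> 'a pt set \<Rightarrow> enat" where
  "s_F n X A Z = Sup {enat e | e. e \<ge> 1 \<and> separates_frobenius_jets n X A Z e}"

definition eps_F :: "nat \<Rightarrow> 'a::field pt set \<Rightarrow> ('i, 'a) lbundle \<Rightarrow> 'a pt set \<Rightarrow> ereal" where
  "eps_F n X L Z = (SUP m\<in>{1..}.
     (case s_F n X (tensor_power L m) Z of
        enat e \<Rightarrow> ereal ((real CHAR('a) ^ e - 1) / real m)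
      | \<infinity> \<Rightarrow> \<infinity>))"

end

theory Submission
  imports Defs
begin

text \<open>
  Write \<open>q = p\<^sup>e\<close>. The proof rests on two ways of producing bundles that separate Frobenius jets.

  \<^item> If \<open>L\<^sup>a\<close> separates \<open>p\<^sup>e\<close>-jets and \<open>L\<^sup>b\<close> separates \<open>p\<^bsup>e'\<^esup>\<close>-jets, then \<open>L\<^bsup>a + q b\<^esup>\<close> separates
    \<open>p\<^bsup>e + e'\<^esup>\<close>-jets (\<open>sep_add\<close>). Let \<open>m\<close> be the maximal ideal at a point of \<open>Z\<close> and \<open>q' = p\<^bsup>e'\<^esup>\<close>.
    Suppose a jet is already matched modulo \<open>(m\<^sup>N)\<^bsup>[q]\<^esup> + m\<^bsup>[q q']\<^esup>\<close>. The error is a sum of terms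
    \<open>x y\<^sup>q\<close> with \<open>y \<in> m\<^sup>N\<close>. Choose a section \<open>s\<close> of \<open>L\<^sup>a\<close> congruent to \<open>x\<close> modulo \<open>m\<^bsup>[q]\<^esup>\<close> and a section
    \<open>t\<close> of \<open>L\<^sup>b\<close> congruent to \<open>y\<close> modulo \<open>m\<^bsup>[q']\<^esup>\<close>, both congruent to \<open>0\<close> at the other points. Since
    \<open>t \<mapsto> t\<^sup>q\<close> is additive, the section \<open>s t\<^sup>q\<close> of \<open>L\<^bsup>a + q b\<^esup>\<close> matches \<open>x y\<^sup>q\<close> modulo
    \<open>(m\<^bsup>N + 1\<^esup>)\<^bsup>[q]\<^esup> + m\<^bsup>[q q']\<^esup>\<close>. So \<open>N\<close> can be raised indefinitely. As \<open>m\<close> is finitely generated,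
    \<open>m\<^sup>N \<subseteq> m\<^bsup>[q']\<^esup>\<close> for large \<open>N\<close>, and the modulus becomes \<open>m\<^bsup>[q q']\<^esup>\<close>.

  \<^item> If \<open>L\<^sup>m\<close> separates \<open>p\<^sup>e\<close>-jets, then it has a section with value \<open>1\<close> at every point of \<open>Z\<close>
    (\<open>sep_unit_section\<close>); multiplying by its powers shows that \<open>L\<^bsup>m + j m\<^esup>\<close> separates \<open>p\<^sup>e\<close>-jets for
    every \<open>j\<close> (\<open>sep_add_unit_multiple\<close>).

  Iterating the first fact, if \<open>L\<^sup>m\<close> separates \<open>p\<^sup>e\<close>-jets, then \<open>L\<^bsup>m d\<^esup>\<close> with
  \<open>d = 1 + q + \<dots> + q\<^bsup>k - 1\<^esup>\<close> separates \<open>p\<^bsup>k e\<^esup>\<close>-jets, and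
  \<open>(p\<^bsup>k e\<^esup> - 1) / (m d) = (p\<^sup>e - 1) / m\<close>. By the second fact \<open>d\<close> may be replaced by a multiple
  \<open>d + j\<close> of \<open>r\<close> with \<open>j < r\<close>. The resulting power of \<open>L\<close> is a power of \<open>L\<^sup>r\<close>, and the ratio changes by the
  factor \<open>d / (d + j)\<close>, which tends to \<open>1\<close> as \<open>k\<close> grows. This gives
  \<open>r \<cdot> \<epsilon>\<^sub>F(L; Z) \<le> \<epsilon>\<^sub>F(L\<^sup>r; Z)\<close> (\<open>eps_F_term_le\<close>). The reverse inequality holds because the powers
  of \<open>L\<^sup>r\<close> are among those of \<open>L\<close>.

  Separation is a condition on sheaves; \<open>separates_iff_local\<close> rephrases it as the approximation of
  arbitrary germs at the points of \<open>Z\<close> by one global section.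
\<close>


section \<open>Ideals in a ring of germs of functions\<close>

text \<open>
  \<open>powers q G\<close> and \<open>products N M\<close> are sets of functions, not ideals. In a ring of germs,
  \<open>products N M\<close> generates the \<open>N\<close>-th power of the ideal generated by \<open>M\<close>, and \<open>powers q G\<close>, for \<open>q\<close> a
  power of the characteristic \<open>p > 0\<close>, generates the Frobenius power of the ideal generated by \<open>G\<close>.
\<close>

definition powers :: "nat \<Rightarrow> ('x \<Rightarrow> 'a::monoid_mult) set \<Rightarrow> ('x \<Rightarrow> 'a) set" where
  "powers q G = (\<lambda>g x. g x ^ q) ` G"

lemma powersI: "g \<in> G \<Longrightarrow> (\<lambda>x. g x ^ q) \<in> powers q G"
  unfolding powers_def by (rule imageI)

lemma powers_powers: "powers k (powers q G) = powers (q * k) G"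
  by (simp add: powers_def image_image power_mult)

fun products :: "nat \<Rightarrow> ('x \<Rightarrow> 'a::monoid_mult) set \<Rightarrow> ('x \<Rightarrow> 'a) set" where
  "products 0 M = {\<lambda>_. 1}"
| "products (Suc N) M = {\<lambda>x. g x * h x | g h. g \<in> M \<and> h \<in> products N M}"

text \<open>
  Germs are represented by functions: \<open>R\<close> is a ring of functions containing the constants, and two
  functions have the same germ if they agree eventually along the filter \<open>F\<close>. In the application
  \<open>F\<close> is the neighbourhood filter of a point and \<open>R\<close> consists of the functions regular near it.
\<close>
locale germ_ring =
  fixes F :: "'x filter" and R :: "('x \<Rightarrow> 'a::comm_ring_1) set"
  assumes const: "(\<lambda>_. c) \<in> R"
    and add: "f \<in> R \<Longrightarrow> g \<in> R \<Longrightarrow> (\<lambda>x. f x + g x) \<in> R"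
    and mult: "f \<in> R \<Longrightarrow> g \<in> R \<Longrightarrow> (\<lambda>x. f x * g x) \<in> R"
begin

lemma power: "f \<in> R \<Longrightarrow> (\<lambda>x. f x ^ k) \<in> R"
  by (induction k) (auto intro: const mult)

lemma sum: "(\<And>j. j \<in> A \<Longrightarrow> f j \<in> R) \<Longrightarrow> (\<lambda>x. \<Sum>j\<in>A. f j x) \<in> R"
  by (induction A rule: infinite_finite_induct) (auto intro: const add)

lemma prod: "(\<And>j. j \<in> A \<Longrightarrow> f j \<in> R) \<Longrightarrow> (\<lambda>x. \<Prod>j\<in>A. f j x) \<in> R"
  by (induction A rule: infinite_finite_induct) (auto intro: const mult)

text \<open>
  The functions whose germ lies in the ideal generated by the germs of \<open>G\<close>. The inductive form, one
  generator at a time, avoids indexed families of coefficients; \<open>ideal_gen_iff_sum\<close> recovers the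
  description by finite sums.
\<close>
inductive_set ideal_gen :: "('x \<Rightarrow> 'a) set \<Rightarrow> ('x \<Rightarrow> 'a) set" for G where
  zero: "(\<forall>\<^sub>F x in F. f x = 0) \<Longrightarrow> f \<in> ideal_gen G"
| step: "f \<in> ideal_gen G \<Longrightarrow> a \<in> R \<Longrightarrow> g \<in> G \<Longrightarrow> (\<forall>\<^sub>F x in F. h x = f x + a x * g x) \<Longrightarrow>
    h \<in> ideal_gen G"

lemma ideal_gen_cong:
  assumes "f \<in> ideal_gen G" "\<forall>\<^sub>F x in F. f x = h x"
  shows "h \<in> ideal_gen G"
  using assms(1)
proof cases
  case zero
  have "\<forall>\<^sub>F x in F. h x = 0" using zero assms(2) by eventually_elim simp
  then show ?thesis by (rule ideal_gen.zero)
next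
  case (step f' a g)
  have "\<forall>\<^sub>F x in F. h x = f' x + a x * g x" using step(4) assms(2) by eventually_elim simp
  with step(1-3) show ?thesis by (rule ideal_gen.step)
qed

lemma ideal_gen_base:
  assumes "g \<in> G" shows "g \<in> ideal_gen G"
proof (rule ideal_gen.step[OF _ const[of 1] assms])
  show "(\<lambda>_. 0) \<in> ideal_gen G" by (rule ideal_gen.zero) simp
qed simp

lemma ideal_gen_add:
  assumes "f \<in> ideal_gen G" "h \<in> ideal_gen G"
  shows "(\<lambda>x. f x + h x) \<in> ideal_gen G"
  using assms(1)
proof induction
  case (zero f)
  then have "\<forall>\<^sub>F x in F. h x = f x + h x" by eventually_elim simp
  then show ?case by (rule ideal_gen_cong[OF assms(2)])
next
  case (step f a g k)
  show ?case
  proof (rule ideal_gen.step[OF step.IH step.hyps(2,3)])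
    show "\<forall>\<^sub>F x in F. k x + h x = f x + h x + a x * g x"
      using step.hyps(4) by eventually_elim simp
  qed
qed

lemma ideal_gen_mult:
  assumes "a \<in> R" "f \<in> ideal_gen G"
  shows "(\<lambda>x. a x * f x) \<in> ideal_gen G"
  using assms(2)
proof induction
  case (zero f)
  then have "\<forall>\<^sub>F x in F. a x * f x = 0" by eventually_elim simp
  then show ?case by (rule ideal_gen.zero)
next
  case (step f b g k)
  show ?case
  proof (rule ideal_gen.step[OF step.IH mult[OF assms(1) step.hyps(2)] step.hyps(3)])
    show "\<forall>\<^sub>F x in F. a x * k x = a x * f x + a x * b x * g x"
      using step.hyps(4) by eventually_elim (simp add: algebra_simps)
  qed
qed

lemma ideal_gen_sum:
  assumes "finite A" "\<And>j. j \<in> A \<Longrightarrow> f j \<in> ideal_gen G"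
  shows "(\<lambda>x. \<Sum>j\<in>A. f j x) \<in> ideal_gen G"
  using assms
proof (induction A rule: finite_induct)
  case empty
  then show ?case by (intro ideal_gen.zero) simp
qed (simp add: ideal_gen_add)

lemma ideal_gen_least:
  assumes "G \<subseteq> ideal_gen H" shows "ideal_gen G \<subseteq> ideal_gen H"
proof
  fix f assume "f \<in> ideal_gen G"
  then show "f \<in> ideal_gen H"
  proof induction
    case (step f a g h)
    have "(\<lambda>x. f x + a x * g x) \<in> ideal_gen H"
      using step assms by (intro ideal_gen_add ideal_gen_mult) auto
    then show ?case
      by (rule ideal_gen_cong) (use step.hyps(4) in eventually_elim, simp)
  qed (rule ideal_gen.zero)
qed

lemma ideal_gen_mono: "G \<subseteq> H \<Longrightarrow> ideal_gen G \<subseteq> ideal_gen H"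
  by (rule ideal_gen_least) (auto intro: ideal_gen_base)

lemma ideal_gen_prod:
  assumes "f \<in> ideal_gen G" "h \<in> ideal_gen H"
    and GH: "\<And>g k. g \<in> G \<Longrightarrow> k \<in> H \<Longrightarrow> (\<lambda>x. g x * k x) \<in> ideal_gen K"
  shows "(\<lambda>x. f x * h x) \<in> ideal_gen K"
proof -
  have 1: "(\<lambda>x. g x * h x) \<in> ideal_gen K" if "g \<in> G" for g
    using assms(2)
  proof induction
    case (zero h)
    then have "\<forall>\<^sub>F x in F. g x * h x = 0" by eventually_elim simp
    then show ?case by (rule ideal_gen.zero)
  next
    case (step h b k h')
    have "(\<lambda>x. g x * h x + b x * (g x * k x)) \<in> ideal_gen K"
      by (rule ideal_gen_add[OF step.IH ideal_gen_mult[OF step.hyps(2) GH[OF that step.hyps(3)]]])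
    then show ?case
      by (rule ideal_gen_cong) (use step.hyps(4) in eventually_elim, simp add: algebra_simps)
  qed
  show ?thesis using assms(1)
  proof induction
    case (zero f)
    then have "\<forall>\<^sub>F x in F. f x * h x = 0" by eventually_elim simp
    then show ?case by (rule ideal_gen.zero)
  next
    case (step f b g f')
    have "(\<lambda>x. f x * h x + b x * (g x * h x)) \<in> ideal_gen K"
      by (rule ideal_gen_add[OF step.IH ideal_gen_mult[OF step.hyps(2) 1[OF step.hyps(3)]]])
    then show ?case
      by (rule ideal_gen_cong) (use step.hyps(4) in eventually_elim, simp add: algebra_simps)
  qed
qed

lemma ideal_gen_iff_sum:
  "f \<in> ideal_gen G \<longleftrightarrow> (\<exists>r a g. (\<forall>j<r. a j \<in> R \<and> g j \<in> G) \<and>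
     (\<forall>\<^sub>F x in F. f x = (\<Sum>j<(r::nat). a j x * g j x)))" (is "_ \<longleftrightarrow> ?S f")
proof
  assume "f \<in> ideal_gen G"
  then show "?S f"
  proof induction
    case (zero f)
    then show ?case by (intro exI[of _ 0]) simp
  next
    case (step f b h k)
    from step.IH obtain r a g where
      ag: "\<forall>j<r. a j \<in> R \<and> g j \<in> G" "\<forall>\<^sub>F x in F. f x = (\<Sum>j<(r::nat). a j x * g j x)" by blast
    show ?case
    proof (intro exI conjI)
      show "\<forall>j<Suc r. (a(r := b)) j \<in> R \<and> (g(r := h)) j \<in> G"
        using ag(1) step.hyps by (auto simp: less_Suc_eq)
      show "\<forall>\<^sub>F x in F. k x = (\<Sum>j<Suc r. (a(r := b)) j x * (g(r := h)) j x)"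
        using step.hyps(4) ag(2) by eventually_elim simp
    qed
  qed
next
  assume "?S f"
  then obtain r a g where
      ag: "\<forall>j<r. a j \<in> R \<and> g j \<in> G" "\<forall>\<^sub>F x in F. f x = (\<Sum>j<(r::nat). a j x * g j x)" by blast
  have "(\<lambda>x. \<Sum>j<r. a j x * g j x) \<in> ideal_gen G"
    using ag(1) by (intro ideal_gen_sum ideal_gen_mult ideal_gen_base) auto
  then show "f \<in> ideal_gen G"
    by (rule ideal_gen_cong) (use ag(2) in eventually_elim, simp)
qed

text \<open>
  The Frobenius map is additive, so the \<open>p\<^sup>e\<close>-th power of a combination of elements of \<open>G\<close> is a
  combination of their \<open>p\<^sup>e\<close>-th powers.
\<close>
lemma powers_ideal_gen:
  assumes "prime CHAR('a)" "f \<in> ideal_gen G"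
  shows "(\<lambda>x. f x ^ CHAR('a) ^ e) \<in> ideal_gen (powers (CHAR('a) ^ e) G)"
  using assms(2)
proof induction
  case (zero f)
  then have "\<forall>\<^sub>F x in F. f x ^ CHAR('a) ^ e = 0"
    by eventually_elim (use assms(1) in \<open>auto simp: power_0_left prime_gt_0_nat\<close>)
  then show ?case by (rule ideal_gen.zero)
next
  case (step f a g h)
  show ?case
  proof (rule ideal_gen.step[OF step.IH power[OF step.hyps(2)] powersI[OF step.hyps(3)]])
    show "\<forall>\<^sub>F x in F. h x ^ CHAR('a) ^ e =
        f x ^ CHAR('a) ^ e + a x ^ CHAR('a) ^ e * g x ^ CHAR('a) ^ e"
      using step.hyps(4)
      by eventually_elim (simp add: freshmans_dream'[OF assms(1) refl] power_mult_distrib)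
  qed
qed

lemma products_in: "M \<subseteq> R \<Longrightarrow> f \<in> products N M \<Longrightarrow> f \<in> R"
  by (induction N arbitrary: f) (auto intro: const mult)

text \<open>
  If \<open>m\<close> is generated by \<open>n + 1\<close> elements, then \<open>m\<^sup>N \<subseteq> m\<^bsup>[q]\<^esup>\<close> once \<open>N \<ge> (n + 1) q\<close>: by the
  pigeonhole principle every monomial of degree \<open>N\<close> in the generators contains a \<open>q\<close>-th power.
\<close>
lemma products_subset_ideal_gen_powers:
  fixes u :: "nat \<Rightarrow> 'x \<Rightarrow> 'a"
  assumes M: "M \<subseteq> ideal_gen (u ` {..n})" and u: "\<And>i. i \<le> n \<Longrightarrow> u i \<in> M" and MR: "M \<subseteq> R"
    and N: "Suc n * q \<le> N"
  shows "products N M \<subseteq> ideal_gen (powers q M)"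
proof -
  define E where "E N = {\<lambda>x. \<Prod>i\<le>n. u i x ^ \<alpha> i | \<alpha>. (\<Sum>i\<le>n. \<alpha> i) = N}" for N
  have "products N M \<subseteq> ideal_gen (E N)" for N
  proof (induction N)
    case 0
    have "(\<lambda>_. 1) \<in> E 0" unfolding E_def by (intro CollectI exI[of _ "\<lambda>_. 0"]) auto
    then show ?case by (auto intro: ideal_gen_base)
  next
    case (Suc N)
    have "(\<lambda>x. g x * h x) \<in> ideal_gen (E (Suc N))" if "g \<in> M" "h \<in> products N M" for g h
    proof (rule ideal_gen_prod)
      show "g \<in> ideal_gen (u ` {..n})" "h \<in> ideal_gen (E N)" using that M Suc by auto
      fix v w assume "v \<in> u ` {..n}" "w \<in> E N"
      then obtain i \<alpha> where i: "v = u i" "i \<le> n" and w: "w = (\<lambda>x. \<Prod>i\<le>n. u i x ^ \<alpha> i)"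
        and \<alpha>: "(\<Sum>i\<le>n. \<alpha> i) = N" by (auto simp: E_def)
      have "(\<lambda>x. v x * w x) = (\<lambda>x. \<Prod>j\<le>n. u j x ^ (\<alpha>(i := Suc (\<alpha> i))) j)"
      proof
        fix x
        have "(\<Prod>j\<le>n. u j x ^ (\<alpha>(i := Suc (\<alpha> i))) j) =
            (\<Prod>j\<le>n. (if j = i then u i x else 1) * u j x ^ \<alpha> j)"
          by (intro prod.cong) auto
        then show "v x * w x = (\<Prod>j\<le>n. u j x ^ (\<alpha>(i := Suc (\<alpha> i))) j)"
          using i w by (simp add: prod.distrib)
      qed
      moreover have "(\<Sum>j\<le>n. (\<alpha>(i := Suc (\<alpha> i))) j) = Suc N"
      proof -
        have "(\<Sum>j\<le>n. (\<alpha>(i := Suc (\<alpha> i))) j) = (\<Sum>j\<le>n. (if j = i then 1 else 0) + \<alpha> j)"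
          by (intro sum.cong) auto
        then show ?thesis using i \<alpha> by (simp add: sum.distrib)
      qed
      ultimately have "(\<lambda>x. v x * w x) \<in> E (Suc N)" unfolding E_def by blast
      then show "(\<lambda>x. v x * w x) \<in> ideal_gen (E (Suc N))" by (rule ideal_gen_base)
    qed
    then show ?case by auto
  qed
  moreover have "E N \<subseteq> ideal_gen (powers q M)"
  proof
    fix w assume "w \<in> E N"
    then obtain \<alpha> where w: "w = (\<lambda>x. \<Prod>i\<le>n. u i x ^ \<alpha> i)"
        and \<alpha>: "(\<Sum>i\<le>n. \<alpha> i) = N" by (auto simp: E_def)
    have "\<exists>i\<le>n. q \<le> \<alpha> i"
    proof (rule ccontr)
      assume "\<not> ?thesis"
      then have "(\<Sum>i\<le>n. \<alpha> i) < (\<Sum>i\<le>n. q)" by (intro sum_strict_mono) auto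
      with \<alpha> N show False by simp
    qed
    then obtain i where i: "i \<le> n" "q \<le> \<alpha> i" by blast
    define b where "b = (\<lambda>x. u i x ^ (\<alpha> i - q) * (\<Prod>j\<in>{..n}-{i}. u j x ^ \<alpha> j))"
    have "b \<in> R" unfolding b_def using i u MR by (intro mult power prod) auto
    moreover have "w = (\<lambda>x. b x * u i x ^ q)"
    proof
      fix x
      have "w x = u i x ^ \<alpha> i * (\<Prod>j\<in>{..n}-{i}. u j x ^ \<alpha> j)"
        unfolding w using i by (subst prod.remove[of _ i]) auto
      also have "u i x ^ \<alpha> i = u i x ^ (\<alpha> i - q) * u i x ^ q"
        using i by (simp flip: power_add)
      finally show "w x = b x * u i x ^ q" by (simp add: b_def mult_ac)
    qed
    moreover have "(\<lambda>x. u i x ^ q) \<in> ideal_gen (powers q M)"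
      using u i by (intro ideal_gen_base powersI) auto
    ultimately show "w \<in> ideal_gen (powers q M)" using ideal_gen_mult by metis
  qed
  ultimately show ?thesis using ideal_gen_least by blast
qed

text \<open>
  Congruence to a constant modulo an ideal is compatible with finite products.
\<close>
lemma ideal_gen_prod_cong:
  assumes "finite A" "\<And>j. j \<in> A \<Longrightarrow> f j \<in> R"
    and "\<And>j. j \<in> A \<Longrightarrow> (\<lambda>x. f j x - c j) \<in> ideal_gen G"
  shows "(\<lambda>x. (\<Prod>j\<in>A. f j x) - (\<Prod>j\<in>A. c j)) \<in> ideal_gen G"
  using assms
proof (induction A rule: finite_induct)
  case empty
  then show ?case by (auto intro: ideal_gen.zero)
next
  case (insert i A)
  have "(\<lambda>x. f i x * ((\<Prod>j\<in>A. f j x) - (\<Prod>j\<in>A. c j)) + (\<Prod>j\<in>A. c j) * (f i x - c i))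
      \<in> ideal_gen G"
    using insert by (intro ideal_gen_add ideal_gen_mult const) auto
  then show ?case using insert.hyps by (simp add: algebra_simps)
qed

lemma ideal_gen_power_cong:
  assumes "f \<in> R" "(\<lambda>x. f x - c) \<in> ideal_gen G"
  shows "(\<lambda>x. f x ^ k - c ^ k) \<in> ideal_gen G"
  using ideal_gen_prod_cong[of "{..<k}" "\<lambda>_. f" "\<lambda>_. c" G] assms by simp

end

section \<open>Regular functions and local rings of a projective variety\<close>

lemma form_const: "form n 0 (\<lambda>_. c)"
proof -
  have "exponents n 0 = {\<lambda>_. 0}"
    by (auto simp: exponents_def fun_eq_iff) (meson atMost_iff not_le)
  then show ?thesis by (auto simp: form_def intro!: exI[of _ "\<lambda>_. c"])
qed

lemma form_coord:
  assumes "i \<le> n" shows "form n 1 (\<lambda>v::nat \<Rightarrow> 'a::field. v i)"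
  unfolding form_def
proof (intro exI allI)
  fix v :: "nat \<Rightarrow> 'a"
  define \<delta> where "\<delta> = (\<lambda>j. if j = i then 1 else 0 :: nat)"
  have \<delta>: "\<delta> \<in> exponents n 1" using assms by (auto simp: exponents_def \<delta>_def)
  have "(\<Sum>\<alpha>\<in>exponents n 1. (if \<alpha> = \<delta> then 1 else 0) * (\<Prod>j\<le>n. v j ^ \<alpha> j)) =
      (\<Sum>\<alpha>\<in>exponents n 1. if \<alpha> = \<delta> then (\<Prod>j\<le>n. v j ^ \<delta> j) else 0)"
    by (intro sum.cong) auto
  also have "\<dots> = (\<Prod>j\<le>n. v j ^ \<delta> j)" using \<delta> finite_exponents by simp
  also have "\<dots> = (\<Prod>j\<le>n. if j = i then v j else 1)"
    by (intro prod.cong) (auto simp: \<delta>_def)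
  also have "\<dots> = v i" using assms by simp
  finally show "v i = (\<Sum>\<alpha>\<in>exponents n 1. (if \<alpha> = \<delta> then 1 else 0) * (\<Prod>j\<le>n. v j ^ \<alpha> j))"
    by simp
qed

lemma form_add:
  assumes "form n d F" "form n d G" shows "form n d (\<lambda>v. F v + G v)"
proof -
  obtain a b where "\<And>v. F v = (\<Sum>\<alpha>\<in>exponents n d. a \<alpha> * (\<Prod>i\<le>n. v i ^ \<alpha> i))"
    and "\<And>v. G v = (\<Sum>\<alpha>\<in>exponents n d. b \<alpha> * (\<Prod>i\<le>n. v i ^ \<alpha> i))"
    using assms by (auto simp: form_def)
  then show ?thesis unfolding form_def
    by (intro exI[of _ "\<lambda>\<alpha>. a \<alpha> + b \<alpha>"]) (simp add: sum.distrib algebra_simps)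
qed

lemma form_cmult: "form n d F \<Longrightarrow> form n d (\<lambda>v. c * F v)"
  using form_mult[OF form_const] by simp

lemma proj_pt_self: "v \<in> proj_pt v"
  unfolding proj_pt_def by (intro CollectI exI[of _ 1]) simp

lemma proj_pt_eq:
  assumes "w \<in> proj_pt v" shows "proj_pt w = proj_pt v"
proof -
  obtain c where c: "w = (\<lambda>i. c * v i)" "c \<noteq> 0" using assms by (auto simp: proj_pt_def)
  show ?thesis
  proof (intro equalityI subsetI)
    fix u assume "u \<in> proj_pt w"
    then obtain b where "u = (\<lambda>i. b * w i)" "b \<noteq> 0" by (auto simp: proj_pt_def)
    then show "u \<in> proj_pt v" unfolding proj_pt_def using c
      by (intro CollectI exI[of _ "b * c"]) auto
  next
    fix u assume "u \<in> proj_pt v"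
    then obtain b where "u = (\<lambda>i. b * v i)" "b \<noteq> 0" by (auto simp: proj_pt_def)
    then show "u \<in> proj_pt w" unfolding proj_pt_def using c
      by (intro CollectI exI[of _ "b / c"]) auto
  qed
qed

lemma proj_space_cases:
  assumes "P \<in> proj_space n" "v \<in> P"
  shows "P = proj_pt v" "\<exists>i\<le>n. v i \<noteq> 0" "\<forall>i>n. v i = 0"
proof -
  obtain w where w: "P = proj_pt w" "w \<noteq> (\<lambda>_. 0)" "\<forall>i>n. w i = 0"
    using assms by (auto simp: proj_space_def)
  then obtain c where c: "v = (\<lambda>i. c * w i)" "c \<noteq> 0"
    using assms by (auto simp: proj_pt_def)
  show "P = proj_pt v" using w assms(2) proj_pt_eq by blast
  show "\<forall>i>n. v i = 0" using c w by simp
  obtain i where "w i \<noteq> 0" using w(2) by auto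
  moreover have "i \<le> n" using \<open>w i \<noteq> 0\<close> w(3) not_le by blast
  ultimately show "\<exists>i\<le>n. v i \<noteq> 0" using c by auto
qed

lemma proj_space_nonempty: "P \<in> proj_space n \<Longrightarrow> \<exists>v. v \<in> P"
  using proj_pt_self unfolding proj_space_def by blast

lemma openin_nonvanishing: "form n d F \<Longrightarrow> openin (zariski n) (nonvanishing n {F})"
  unfolding openin_zariski zariski_open_def by (intro exI[of _ "{F}"]) auto

text \<open>
  The point with coordinates \<open>v\<close> is cut out by the linear forms \<open>v\<^sub>i x\<^sub>j - v\<^sub>j x\<^sub>i\<close>.
\<close>
lemma closedin_point:
  assumes P: "P \<in> proj_space n" shows "closedin (zariski n) {P}"
proof -
  obtain v where v: "v \<in> P" using P proj_space_nonempty by blast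
  define S where "S = {\<lambda>w. v i * w j - v j * w i | i j. i \<le> n \<and> j \<le> n}"
  have S1: "\<exists>d. form n d F" if F: "F \<in> S" for F
  proof -
    obtain i j where ij: "F = (\<lambda>w. v i * w j - v j * w i)" "i \<le> n" "j \<le> n"
      using F by (auto simp: S_def)
    have "form n 1 (\<lambda>w. v i * w j + (- v j) * w i)"
      using ij by (intro form_add form_cmult form_coord)
    then show ?thesis using ij by auto
  qed
  have S2: "proj_space n - {P} = nonvanishing n S"
  proof (intro equalityI subsetI)
    fix Q assume Q: "Q \<in> nonvanishing n S"
    then obtain i j w where w: "w \<in> Q" "v i * w j - v j * w i \<noteq> 0" "Q \<in> proj_space n"
      by (auto simp: nonvanishing_def S_def)
    have "Q \<noteq> P"
    proof
      assume "Q = P"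
      then have "w \<in> proj_pt v" using w proj_space_cases(1)[OF P v] by simp
      then show False using w(2) by (auto simp: proj_pt_def)
    qed
    then show "Q \<in> proj_space n - {P}" using w by simp
  next
    fix Q assume Q: "Q \<in> proj_space n - {P}"
    show "Q \<in> nonvanishing n S"
    proof (rule ccontr)
      assume neg: "Q \<notin> nonvanishing n S"
      obtain w where w: "w \<in> Q" using Q proj_space_nonempty by blast
      have eq: "v i * w j = v j * w i" if "i \<le> n" "j \<le> n" for i j
      proof -
        have "(\<lambda>w. v i * w j - v j * w i) \<in> S" using that by (auto simp: S_def)
        then show ?thesis using neg Q w by (auto simp: nonvanishing_def)
      qed
      obtain i where i: "i \<le> n" "v i \<noteq> 0" using proj_space_cases(2)[OF P v] by blast
      obtain k where k: "k \<le> n" "w k \<noteq> 0" using proj_space_cases(2)[of Q, OF _ w] Q by blast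
      have "w j = w i / v i * v j" for j
      proof (cases "j \<le> n")
        case True
        then show ?thesis using eq[of i j] i by (simp add: field_simps)
      next
        case False
        then show ?thesis using proj_space_cases(3)[OF P v] proj_space_cases(3)[of Q n, OF _ w] Q
          by simp
      qed
      then have wv: "w = (\<lambda>j. w i / v i * v j)" by blast
      have "w i / v i \<noteq> 0" using fun_cong[OF wv, of k] k by auto
      with wv have "w \<in> proj_pt v" unfolding proj_pt_def by blast
      then have "proj_pt w = proj_pt v" by (rule proj_pt_eq)
      then show False using proj_space_cases(1)[OF P v] proj_space_cases(1)[of Q n, OF _ w] Q by simp
    qed
  qed
  have "openin (zariski n) (proj_space n - {P})"
    unfolding openin_zariski zariski_open_def by (intro exI[of _ S] conjI ballI S1 S2)
  then show ?thesis using P by (simp add: closedin_def topspace_zariski)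
qed

lemma topspace_top_of: "X \<subseteq> proj_space n \<Longrightarrow> topspace (top_of n X) = X"
  by (auto simp: topspace_zariski)

lemma openin_diff_finite:
  assumes "X \<subseteq> proj_space n" "finite Z"
  shows "openin (top_of n X) (X - Z)"
proof -
  have "closedin (zariski n) (\<Union>P\<in>Z \<inter> X. {P})"
    using assms by (intro closedin_Union) (auto intro!: closedin_point)
  then have "openin (zariski n) (proj_space n - Z \<inter> X)"
    by (simp add: closedin_def topspace_zariski)
  moreover have "X - Z = X \<inter> (proj_space n - Z \<inter> X)" using assms by auto
  ultimately show ?thesis by (metis openin_subtopology_Int2)
qed

lemma regular_on_const: "openin (top_of n X) U \<Longrightarrow> (\<lambda>_. c) \<in> regular_on n X U"
  unfolding regular_on_def
  by (intro CollectI ballI exI[of _ U] exI[of _ 0] exI[of _ "\<lambda>_. c"] exI[of _ "\<lambda>_. 1"])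
     (auto intro: form_const)

lemma regular_onE:
  assumes "f \<in> regular_on n X U" "P \<in> U"
  obtains W d g h where "openin (top_of n X) W" "P \<in> W" "W \<subseteq> U" "form n d g" "form n d h"
    "\<forall>Q\<in>W. \<forall>v\<in>Q. h v \<noteq> 0 \<and> f Q = g v / h v"
  using bspec[OF assms(1)[unfolded regular_on_def mem_Collect_eq] assms(2)]
  by (elim exE conjE) (rule that)

lemma regular_on_mult:
  assumes "f \<in> regular_on n X U" "g \<in> regular_on n X U"
  shows "(\<lambda>Q. f Q * g Q) \<in> regular_on n X U"
  unfolding regular_on_def
proof (intro CollectI ballI)
  fix P assume P: "P \<in> U"
  obtain W d a b where
    1: "openin (top_of n X) W" "P \<in> W" "W \<subseteq> U" "form n d a" "form n d b"
       "\<forall>Q\<in>W. \<forall>v\<in>Q. b v \<noteq> 0 \<and> f Q = a v / b v"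
    by (rule regular_onE[OF assms(1) P])
  obtain W' d' a' b' where
    2: "openin (top_of n X) W'" "P \<in> W'" "W' \<subseteq> U" "form n d' a'" "form n d' b'"
       "\<forall>Q\<in>W'. \<forall>v\<in>Q. b' v \<noteq> 0 \<and> g Q = a' v / b' v"
    by (rule regular_onE[OF assms(2) P])
  show "\<exists>W d h k. openin (top_of n X) W \<and> P \<in> W \<and> W \<subseteq> U \<and> form n d h \<and> form n d k \<and>
      (\<forall>Q\<in>W. \<forall>v\<in>Q. k v \<noteq> 0 \<and> f Q * g Q = h v / k v)"
  proof (intro exI conjI ballI)
    show "openin (top_of n X) (W \<inter> W')" using 1(1) 2(1) by (rule openin_Int)
    show "form n (d + d') (\<lambda>v. a v * a' v)" "form n (d + d') (\<lambda>v. b v * b' v)"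
      using 1(4,5) 2(4,5) by (auto intro: form_mult)
    show "P \<in> W \<inter> W'" "W \<inter> W' \<subseteq> U" using 1(2,3) 2(2) by auto
    fix Q v assume Q: "Q \<in> W \<inter> W'" "v \<in> Q"
    then have *: "b v \<noteq> 0" "f Q = a v / b v" "b' v \<noteq> 0" "g Q = a' v / b' v"
      using 1(6) 2(6) by blast+
    show "b v * b' v \<noteq> 0" using * by simp
    show "f Q * g Q = a v * a' v / (b v * b' v)" using * by simp
  qed
qed

lemma regular_on_add:
  assumes "f \<in> regular_on n X U" "g \<in> regular_on n X U"
  shows "(\<lambda>Q. f Q + g Q) \<in> regular_on n X U"
  unfolding regular_on_def
proof (intro CollectI ballI)
  fix P assume P: "P \<in> U"
  obtain W d a b where
    1: "openin (top_of n X) W" "P \<in> W" "W \<subseteq> U" "form n d a" "form n d b"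
       "\<forall>Q\<in>W. \<forall>v\<in>Q. b v \<noteq> 0 \<and> f Q = a v / b v"
    by (rule regular_onE[OF assms(1) P])
  obtain W' d' a' b' where
    2: "openin (top_of n X) W'" "P \<in> W'" "W' \<subseteq> U" "form n d' a'" "form n d' b'"
       "\<forall>Q\<in>W'. \<forall>v\<in>Q. b' v \<noteq> 0 \<and> g Q = a' v / b' v"
    by (rule regular_onE[OF assms(2) P])
  show "\<exists>W d h k. openin (top_of n X) W \<and> P \<in> W \<and> W \<subseteq> U \<and> form n d h \<and> form n d k \<and>
      (\<forall>Q\<in>W. \<forall>v\<in>Q. k v \<noteq> 0 \<and> f Q + g Q = h v / k v)"
  proof (intro exI conjI ballI)
    show "openin (top_of n X) (W \<inter> W')" using 1(1) 2(1) by (rule openin_Int)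
    show "form n (d + d') (\<lambda>v. a v * b' v + b v * a' v)"
      by (intro form_add form_mult 1 2)
    show "form n (d + d') (\<lambda>v. b v * b' v)"
      by (intro form_mult 1 2)
    show "P \<in> W \<inter> W'" "W \<inter> W' \<subseteq> U" using 1(2,3) 2(2) by auto
    fix Q v assume Q: "Q \<in> W \<inter> W'" "v \<in> Q"
    then have *: "b v \<noteq> 0" "f Q = a v / b v" "b' v \<noteq> 0" "g Q = a' v / b' v"
      using 1(6) 2(6) by blast+
    show "b v * b' v \<noteq> 0" using * by simp
    show "f Q + g Q = (a v * b' v + b v * a' v) / (b v * b' v)"
      using * by (simp add: field_simps)
  qed
qed

lemma regular_on_subset:
  assumes "f \<in> regular_on n X U" "openin (top_of n X) V" "V \<subseteq> U"
  shows "f \<in> regular_on n X V"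
  unfolding regular_on_def
proof (intro CollectI ballI)
  fix P assume P: "P \<in> V"
  with assms(3) have PU: "P \<in> U" by blast
  obtain W d a b where
    1: "openin (top_of n X) W" "P \<in> W" "W \<subseteq> U" "form n d a" "form n d b"
       "\<forall>Q\<in>W. \<forall>v\<in>Q. b v \<noteq> 0 \<and> f Q = a v / b v"
    by (rule regular_onE[OF assms(1) PU])
  show "\<exists>W d h k. openin (top_of n X) W \<and> P \<in> W \<and> W \<subseteq> V \<and> form n d h \<and> form n d k \<and>
      (\<forall>Q\<in>W. \<forall>v\<in>Q. k v \<noteq> 0 \<and> f Q = h v / k v)"
    by (intro exI[of _ "W \<inter> V"] exI[of _ d] exI[of _ a] exI[of _ b] conjI ballI openin_Int
          1(1,4,5) assms(2)) (use 1(2,6) P in auto)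
qed

lemma regular_on_diff:
  assumes "openin (top_of n X) U" "f \<in> regular_on n X U" "g \<in> regular_on n X U"
  shows "(\<lambda>Q. f Q - g Q) \<in> regular_on n X U"
  using regular_on_add[OF assms(2) regular_on_mult[OF regular_on_const[OF assms(1), of "-1"] assms(3)]]
  by simp

lemma regular_on_power:
  assumes "openin (top_of n X) U" "f \<in> regular_on n X U"
  shows "(\<lambda>Q. f Q ^ k) \<in> regular_on n X U"
proof (induction k)
  case 0
  show ?case using regular_on_const[OF assms(1), of 1] by simp
next
  case (Suc k)
  show ?case using regular_on_mult[OF assms(2) Suc] by simp
qed

text \<open>
  The functions that are regular in some neighbourhood of \<open>P\<close>; up to equality near \<open>P\<close> they form the
  local ring of \<open>X\<close> at \<open>P\<close>.
\<close>
definition germs :: "nat \<Rightarrow> 'a::field pt set \<Rightarrow> 'a pt \<Rightarrow> ('a pt \<Rightarrow> 'a) set" where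
  "germs n X P = {f. \<exists>V. openin (top_of n X) V \<and> P \<in> V \<and> f \<in> regular_on n X V}"

text \<open>
  The functions representing the maximal ideal of the local ring at \<open>P\<close>.
\<close>
definition max_ideal :: "nat \<Rightarrow> 'a::field pt set \<Rightarrow> 'a pt \<Rightarrow> ('a pt \<Rightarrow> 'a) set" where
  "max_ideal n X P = {f \<in> germs n X P. f P = 0}"

abbreviation near :: "nat \<Rightarrow> 'a::field pt set \<Rightarrow> 'a pt \<Rightarrow> 'a pt filter" where
  "near n X P \<equiv> nhdsin (top_of n X) P"

abbreviation germ_ideal ::
  "nat \<Rightarrow> 'a::field pt set \<Rightarrow> 'a pt \<Rightarrow> ('a pt \<Rightarrow> 'a) set \<Rightarrow> ('a pt \<Rightarrow> 'a) set" where
  "germ_ideal n X P \<equiv> germ_ring.ideal_gen (near n X P) (germs n X P)"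

lemma eventually_near:
  assumes "X \<subseteq> proj_space n" "P \<in> X"
  shows "(\<forall>\<^sub>F Q in near n X P. \<phi> Q) \<longleftrightarrow> (\<exists>V. openin (top_of n X) V \<and> P \<in> V \<and> (\<forall>Q\<in>V. \<phi> Q))"
  using assms by (simp add: eventually_nhdsin topspace_zariski subset_iff)

lemma germsI: "openin (top_of n X) V \<Longrightarrow> P \<in> V \<Longrightarrow> f \<in> regular_on n X V \<Longrightarrow> f \<in> germs n X P"
  unfolding germs_def by blast

lemma openin_self: "X \<subseteq> proj_space n \<Longrightarrow> openin (top_of n X) X"
  using openin_topspace[of "top_of n X"] by (simp only: topspace_top_of)

lemma germ_ring_germs:
  assumes "X \<subseteq> proj_space n" "P \<in> X"
  shows "germ_ring (germs n X P)"
proof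
  show "(\<lambda>_. c) \<in> germs n X P" for c
    by (rule germsI[OF openin_self[OF assms(1)] assms(2) regular_on_const[OF openin_self[OF assms(1)]]])
  fix f g assume "f \<in> germs n X P" "g \<in> germs n X P"
  then obtain V W where *: "openin (top_of n X) V" "P \<in> V" "f \<in> regular_on n X V"
    "openin (top_of n X) W" "P \<in> W" "g \<in> regular_on n X W" by (auto simp: germs_def)
  then have o: "openin (top_of n X) (V \<inter> W)" by auto
  have r: "f \<in> regular_on n X (V \<inter> W)" "g \<in> regular_on n X (V \<inter> W)"
    by (rule regular_on_subset[OF *(3) o] regular_on_subset[OF *(6) o], blast)+
  show "(\<lambda>x. f x + g x) \<in> germs n X P" "(\<lambda>x. f x * g x) \<in> germs n X P"
    using *(2,5) r by (auto intro: germsI[OF o] regular_on_add[OF r] regular_on_mult[OF r])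
qed

lemma germs_inverse:
  assumes X: "X \<subseteq> proj_space n" "P \<in> X" and f: "f \<in> germs n X P" "f P \<noteq> 0"
  shows "(\<lambda>Q. inverse (f Q)) \<in> germs n X P" "\<forall>\<^sub>F Q in near n X P. f Q \<noteq> 0"
proof -
  obtain W d a b where
    1: "openin (top_of n X) W" "P \<in> W" "form n d a" "form n d b"
       "\<forall>Q\<in>W. \<forall>v\<in>Q. b v \<noteq> 0 \<and> f Q = a v / b v"
    using f(1) unfolding germs_def regular_on_def by blast
  define V where "V = W \<inter> nonvanishing n {a}"
  have "openin (top_of n X) (W \<inter> (X \<inter> nonvanishing n {a}))"
    by (intro openin_Int 1(1) openin_subtopology_Int2 openin_nonvanishing[OF 1(3)])
  moreover have "W \<inter> (X \<inter> nonvanishing n {a}) = V"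
    using openin_imp_subset[OF 1(1)] by (auto simp: V_def)
  ultimately have o: "openin (top_of n X) V" by simp
  have VX: "V \<subseteq> X" using openin_imp_subset[OF o] by simp
  obtain w where w: "w \<in> P" using X proj_space_nonempty by blast
  have PV: "P \<in> V" using 1 f(2) X w by (fastforce simp: V_def nonvanishing_def)
  have a: "a v \<noteq> 0" if QV: "Q \<in> V" "v \<in> Q" for Q v
  proof -
    obtain u where "u \<in> Q" "a u \<noteq> 0" using QV by (auto simp: V_def nonvanishing_def)
    then show ?thesis using nonvanishing_at[OF 1(3)] QV VX X(1) by blast
  qed
  have *: "\<forall>Q\<in>V. \<forall>v\<in>Q. a v \<noteq> 0 \<and> inverse (f Q) = b v / a v"
    using 1 a by (auto simp: V_def)
  then have "(\<lambda>Q. inverse (f Q)) \<in> regular_on n X V"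
    unfolding regular_on_def using 1(3,4) o
    by (intro CollectI ballI exI[of _ V] exI[of _ d] exI[of _ b] exI[of _ a]) auto
  with o PV show "(\<lambda>Q. inverse (f Q)) \<in> germs n X P" by (rule germsI)
  have "f Q \<noteq> 0" if QV: "Q \<in> V" for Q
  proof -
    obtain v where "v \<in> Q" using QV VX X proj_space_nonempty by blast
    then show ?thesis using a[OF QV] 1 QV by (auto simp: V_def)
  qed
  then show "\<forall>\<^sub>F Q in near n X P. f Q \<noteq> 0" unfolding eventually_near[OF X] using o PV by blast
qed

text \<open>
  On the chart where the \<open>k\<close>-th coordinate does not vanish, put \<open>y\<^sub>j = x\<^sub>j / x\<^sub>k\<close>. A regular function
  near \<open>P\<close> is a quotient of polynomials in the \<open>y\<^sub>j\<close>, and a polynomial in the \<open>y\<^sub>j\<close> is congruent to its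
  value at \<open>P\<close> modulo the ideal generated by the \<open>y\<^sub>j - y\<^sub>j(P)\<close>. Hence these generate the maximal ideal.
\<close>
lemma max_ideal_finitely_generated:
  assumes X: "X \<subseteq> proj_space n" "P \<in> X"
  obtains u where "\<And>i. i \<le> n \<Longrightarrow> u i \<in> max_ideal n X P"
    "max_ideal n X P \<subseteq> germ_ideal n X P (u ` {..n})"
proof -
  interpret germ_ring "near n X P" "germs n X P" using X by (rule germ_ring_germs)
  have XP: "Q \<in> X \<Longrightarrow> Q \<in> proj_space n" for Q using X by blast
  obtain v where v: "v \<in> P" using X proj_space_nonempty by blast
  obtain k where k: "k \<le> n" "v k \<noteq> 0" using proj_space_cases(2)[OF XP[OF X(2)] v] by blast
  define y where "y j Q = (let w = SOME w. w \<in> Q in w j / w k)" for j and Q :: "'a pt"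
  define D where "D = X \<inter> nonvanishing n {\<lambda>w::nat\<Rightarrow>'a. w k}"
  have D: "openin (top_of n X) D"
    unfolding D_def by (intro openin_subtopology_Int2 openin_nonvanishing[OF form_coord] k)
  have "\<exists>w\<in>P. w k \<noteq> 0" using v k by blast
  then have PD: "P \<in> D" using X(2) XP[OF X(2)] by (simp add: D_def nonvanishing_def)
  have wk: "w k \<noteq> 0" if QD: "Q \<in> D" and w: "w \<in> Q" for Q w
  proof -
    obtain u where "u \<in> Q" "u k \<noteq> 0" "Q \<in> proj_space n"
      using QD by (auto simp: D_def nonvanishing_def)
    then show ?thesis using nonvanishing_at[OF form_coord[OF k(1)] _ _ w] by blast
  qed
  \<comment> \<open>The vector of the \<open>y\<^sub>j\<close> is itself a coordinate vector of \<open>Q\<close>, normalised at index \<open>k\<close>.\<close>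
  have yQ: "(\<lambda>j. y j Q) \<in> Q" if "Q \<in> D" for Q
  proof -
    have Q: "Q \<in> proj_space n" using that X by (auto simp: D_def)
    define w where "w = (SOME w. w \<in> Q)"
    have w: "w \<in> Q" unfolding w_def using someI_ex[OF proj_space_nonempty[OF Q]] .
    have "(\<lambda>j. y j Q) = (\<lambda>j. (1 / w k) * w j)" by (auto simp: y_def w_def Let_def)
    moreover have "1 / w k \<noteq> 0" using wk[OF that w] by simp
    ultimately have "(\<lambda>j. y j Q) \<in> proj_pt w" unfolding proj_pt_def by blast
    then show ?thesis using proj_space_cases(1)[OF Q w] by simp
  qed
  have yw: "y j Q = w j / w k" if "Q \<in> D" "w \<in> Q" for j Q w
  proof -
    have Q: "Q \<in> proj_space n" using that X by (auto simp: D_def)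
    have "(\<lambda>j. y j Q) \<in> proj_pt w" using yQ[OF that(1)] proj_space_cases(1)[OF Q that(2)] by simp
    then obtain c where c: "\<And>j. y j Q = c * w j" unfolding proj_pt_def by (auto simp: fun_eq_iff)
    have "y k Q = 1" using wk[OF that(1)] someI_ex[OF proj_space_nonempty[OF Q]]
      by (simp add: y_def Let_def)
    then have "c * w k = 1" using c[of k] by simp
    then have "c = 1 / w k" using wk[OF that] by (simp add: field_simps)
    then show ?thesis using c by simp
  qed
  have yR: "y j \<in> germs n X P" if "j \<le> n" for j
  proof -
    have "y j \<in> regular_on n X D" unfolding regular_on_def
      by (intro CollectI ballI exI[of _ D] exI[of _ 1] exI[of _ "\<lambda>w. w j"] exI[of _ "\<lambda>w. w k"])
         (use D yw wk that k in \<open>auto simp del: One_nat_def intro: form_coord\<close>)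
    with D PD show ?thesis by (rule germsI)
  qed
  define u where "u j = (\<lambda>Q. y j Q - y j P)" for j
  have u: "u j \<in> max_ideal n X P" if "j \<le> n" for j
    using add[OF yR[OF that] const[of "- y j P"]] by (simp add: u_def max_ideal_def)
  have poly: "(\<lambda>Q. F (\<lambda>j. y j Q)) \<in> germs n X P \<and>
      (\<lambda>Q. F (\<lambda>j. y j Q) - F (\<lambda>j. y j P)) \<in> ideal_gen (u ` {..n})" if dF: "form n d F" for d F
  proof -
    obtain c where F: "\<And>v. F v = (\<Sum>\<alpha>\<in>exponents n d. c \<alpha> * (\<Prod>i\<le>n. v i ^ \<alpha> i))"
      using dF by (auto simp: form_def)
    have "(\<lambda>Q. F (\<lambda>j. y j Q)) \<in> germs n X P"
      unfolding F by (intro sum mult const prod power yR) auto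
    moreover have "(\<lambda>Q. \<Sum>\<alpha>\<in>exponents n d. c \<alpha> * ((\<Prod>i\<le>n. y i Q ^ \<alpha> i) - (\<Prod>i\<le>n. y i P ^ \<alpha> i)))
        \<in> ideal_gen (u ` {..n})"
    proof (intro ideal_gen_sum finite_exponents ideal_gen_mult const ideal_gen_prod_cong
        ideal_gen_power_cong power yR)
      fix j assume "j \<in> {..n}"
      then show "(\<lambda>Q. y j Q - y j P) \<in> ideal_gen (u ` {..n})"
        by (intro ideal_gen_base) (auto simp: u_def)
    qed auto
    ultimately show ?thesis by (simp add: F sum_subtractf algebra_simps)
  qed
  have "max_ideal n X P \<subseteq> ideal_gen (u ` {..n})"
  proof
    fix f assume f: "f \<in> max_ideal n X P"
    obtain W d a b where
      1: "openin (top_of n X) W" "P \<in> W" "form n d a" "form n d b"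
         "\<forall>Q\<in>W. \<forall>v\<in>Q. b v \<noteq> 0 \<and> f Q = a v / b v"
      using f unfolding max_ideal_def germs_def regular_on_def by blast
    have fP: "f P = 0" using f by (simp add: max_ideal_def)
    have b: "b (\<lambda>j. y j P) \<noteq> 0" and "a (\<lambda>j. y j P) = 0"
      using 1(2,5) yQ[OF PD] fP by auto
    then have "(\<lambda>Q. a (\<lambda>j. y j Q)) \<in> ideal_gen (u ` {..n})" using poly[OF 1(3)] by simp
    moreover have "(\<lambda>Q. inverse (b (\<lambda>j. y j Q))) \<in> germs n X P"
      using b conjunct1[OF poly[OF 1(4)]] by (intro germs_inverse(1)[OF X]) auto
    ultimately have *: "(\<lambda>Q. inverse (b (\<lambda>j. y j Q)) * a (\<lambda>j. y j Q)) \<in> ideal_gen (u ` {..n})"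
      by (intro ideal_gen_mult)
    have "\<forall>\<^sub>F Q in near n X P. inverse (b (\<lambda>j. y j Q)) * a (\<lambda>j. y j Q) = f Q"
      unfolding eventually_near[OF X]
    proof (intro exI conjI ballI)
      show "openin (top_of n X) (W \<inter> D)" using 1 D by blast
      show "P \<in> W \<inter> D" using 1 PD by blast
      fix Q assume Q: "Q \<in> W \<inter> D"
      then show "inverse (b (\<lambda>j. y j Q)) * a (\<lambda>j. y j Q) = f Q"
        using 1(5) yQ[of Q] by (simp add: field_simps)
    qed
    with * show "f \<in> ideal_gen (u ` {..n})" by (rule ideal_gen_cong)
  qed
  with u show thesis using that by blast
qed

section \<open>Frobenius powers and line bundles, locally\<close>

lemma ideal_sheaf_germ:
  assumes "openin (top_of n X) V" "P \<in> V" "P \<in> Z" "g \<in> ideal_sheaf n X Z V"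
  shows "g \<in> max_ideal n X P"
proof -
  have g: "g \<in> regular_on n X V" "g P = 0" using assms by (auto simp: ideal_sheaf_def)
  from assms(1,2) g(1) have "g \<in> germs n X P" by (rule germsI)
  with g(2) show ?thesis by (simp add: max_ideal_def)
qed

text \<open>
  For finite \<open>Z\<close> the Frobenius power of the ideal sheaf of \<open>Z\<close> imposes a condition only at the points
  of \<open>Z\<close>, where the stalk of the ideal sheaf is the maximal ideal.
\<close>
lemma frob_power_iff:
  assumes X: "X \<subseteq> proj_space n" and Z: "finite Z" and W: "openin (top_of n X) W"
  shows "f \<in> frob_power n X (ideal_sheaf n X Z) q W \<longleftrightarrow> f \<in> regular_on n X W \<and>
    (\<forall>P\<in>W \<inter> Z. f \<in> germ_ideal n X P (powers q (max_ideal n X P)))"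
proof (intro iffI conjI ballI)
  assume f: "f \<in> frob_power n X (ideal_sheaf n X Z) q W"
  then show "f \<in> regular_on n X W" by (simp add: frob_power_def)
  fix P assume P: "P \<in> W \<inter> Z"
  have PX: "P \<in> X" using P openin_imp_subset[OF W] by blast
  interpret germ_ring "near n X P" "germs n X P" using X PX by (rule germ_ring_germs)
  obtain V r a g where V: "openin (top_of n X) V" "P \<in> V"
    "\<forall>j<r. a j \<in> regular_on n X V \<and> g j \<in> ideal_sheaf n X Z V"
    "\<forall>Q\<in>V. f Q = (\<Sum>j<(r::nat). a j Q * g j Q ^ q)"
    using bspec[OF conjunct2[OF f[unfolded frob_power_def mem_Collect_eq]], of P] P
    by (elim exE conjE IntE) auto
  show "f \<in> ideal_gen (powers q (max_ideal n X P))"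
    unfolding ideal_gen_iff_sum
  proof (intro exI conjI allI impI)
    fix j assume j: "j < r"
    show "a j \<in> germs n X P" using V j by (auto intro: germsI[OF V(1,2)])
    have "g j \<in> max_ideal n X P" using V j P by (auto intro: ideal_sheaf_germ[OF V(1,2)])
    then show "(\<lambda>Q. g j Q ^ q) \<in> powers q (max_ideal n X P)" by (rule powersI)
  next
    show "\<forall>\<^sub>F Q in near n X P. f Q = (\<Sum>j<r. a j Q * g j Q ^ q)"
      unfolding eventually_near[OF X PX] using V by blast
  qed
next
  assume f: "f \<in> regular_on n X W \<and>
    (\<forall>P\<in>W \<inter> Z. f \<in> germ_ideal n X P (powers q (max_ideal n X P)))"
  show "f \<in> frob_power n X (ideal_sheaf n X Z) q W"
    unfolding frob_power_def
  proof (intro CollectI conjI ballI)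
    show "f \<in> regular_on n X W" using f by simp
    fix P assume P: "P \<in> W"
    have PX: "P \<in> X" using P openin_imp_subset[OF W] by blast
    interpret germ_ring "near n X P" "germs n X P" using X PX by (rule germ_ring_germs)
    show "\<exists>V r a g. openin (top_of n X) V \<and> P \<in> V \<and> V \<subseteq> W \<and>
       (\<forall>j<r. a j \<in> regular_on n X V \<and> g j \<in> ideal_sheaf n X Z V) \<and>
       (\<forall>Q\<in>V. f Q = (\<Sum>j<(r::nat). a j Q * g j Q ^ q))"
    proof (cases "P \<in> Z")
      case False
      \<comment> \<open>Away from \<open>Z\<close> the ideal sheaf is the unit ideal: \<open>f = f \<cdot> 1\<^sup>q\<close>.\<close>
      define V where "V = W \<inter> (X - Z)"
      have V: "openin (top_of n X) V" "V \<inter> Z = {}"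
        unfolding V_def by (intro openin_Int W openin_diff_finite X Z) auto
      have "f \<in> regular_on n X V"
        by (rule regular_on_subset[OF conjunct1[OF f] V(1)]) (auto simp: V_def)
      moreover have "(\<lambda>_. 1) \<in> ideal_sheaf n X Z V"
        using V by (auto simp: ideal_sheaf_def intro: regular_on_const)
      ultimately show ?thesis using V P PX False
        by (intro exI[of _ V] exI[of _ 1] exI[of _ "\<lambda>_. f"] exI[of _ "\<lambda>_ _. 1"]) (auto simp: V_def)
    next
      case True
      with f P have "f \<in> ideal_gen (powers q (max_ideal n X P))" by blast
      then obtain r a h where ah: "\<forall>j<r. a j \<in> germs n X P \<and> h j \<in> powers q (max_ideal n X P)"
        "\<forall>\<^sub>F Q in near n X P. f Q = (\<Sum>j<(r::nat). a j Q * h j Q)"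
        unfolding ideal_gen_iff_sum by blast
      have "\<forall>j. \<exists>g. j < r \<longrightarrow> g \<in> max_ideal n X P \<and> h j = (\<lambda>Q. g Q ^ q)"
        using ah(1) by (auto simp: powers_def)
      then obtain g where g: "\<And>j. j < r \<Longrightarrow> g j \<in> max_ideal n X P"
        "\<And>j. j < r \<Longrightarrow> h j = (\<lambda>Q. g j Q ^ q)" by metis
      obtain V0 where V0: "openin (top_of n X) V0" "P \<in> V0"
        "\<forall>Q\<in>V0. f Q = (\<Sum>j<r. a j Q * h j Q)"
        using ah(2) unfolding eventually_near[OF X PX] by blast
      have "\<forall>j. \<exists>V. j < r \<longrightarrow> openin (top_of n X) V \<and> P \<in> V \<and> a j \<in> regular_on n X V"
        using ah(1) by (auto simp: germs_def)
      then obtain A where A: "\<And>j. j < r \<Longrightarrow> openin (top_of n X) (A j)"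
        "\<And>j. j < r \<Longrightarrow> P \<in> A j" "\<And>j. j < r \<Longrightarrow> a j \<in> regular_on n X (A j)" by metis
      have "\<forall>j. \<exists>V. j < r \<longrightarrow> openin (top_of n X) V \<and> P \<in> V \<and> g j \<in> regular_on n X V"
        using g(1) by (auto simp: germs_def max_ideal_def)
      then obtain B where B: "\<And>j. j < r \<Longrightarrow> openin (top_of n X) (B j)"
        "\<And>j. j < r \<Longrightarrow> P \<in> B j" "\<And>j. j < r \<Longrightarrow> g j \<in> regular_on n X (B j)" by metis
      \<comment> \<open>Removing the other points of \<open>Z\<close> makes vanishing on \<open>Z\<close> the same as vanishing at \<open>P\<close>.\<close>
      define V where "V = V0 \<inter> W \<inter> (X - (Z - {P})) \<inter>
        ((\<Inter>j\<in>{..<r}. A j \<inter> B j) \<inter> topspace (top_of n X))"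
      have V: "openin (top_of n X) V"
        unfolding V_def using A B Z
        by (intro openin_Int V0 W openin_diff_finite X openin_INT) auto
      have PV: "P \<in> V" "V \<inter> Z \<subseteq> {P}" "V \<subseteq> W" "V \<subseteq> V0"
        using P PX V0 A B X by (auto simp: V_def topspace_zariski)
      have "a j \<in> regular_on n X V" "g j \<in> ideal_sheaf n X Z V" if j: "j < r" for j
      proof -
        have "V \<subseteq> A j" "V \<subseteq> B j" using j by (auto simp: V_def)
        then have "a j \<in> regular_on n X V" "g j \<in> regular_on n X V"
          using regular_on_subset[OF A(3)[OF j] V] regular_on_subset[OF B(3)[OF j] V] by blast+
        then show "a j \<in> regular_on n X V" "g j \<in> ideal_sheaf n X Z V"
          using g(1)[OF j] PV by (auto simp: ideal_sheaf_def max_ideal_def)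
      qed
      moreover have "\<forall>Q\<in>V. f Q = (\<Sum>j<r. a j Q * g j Q ^ q)"
        using V0(3) PV(4) g(2) by auto
      ultimately show ?thesis using V PV
        by (intro exI[of _ V] exI[of _ r] exI[of _ a] exI[of _ g]) auto
    qed
  qed
qed

lemma chart_open:
  assumes "line_bundle n X A" "i \<in> idx A" shows "openin (top_of n X) (chart A i)"
  using assms by (auto simp: line_bundle_def)

lemma chart_cover: "line_bundle n X A \<Longrightarrow> (\<Union>i\<in>idx A. chart A i) = X"
  by (auto simp: line_bundle_def)

lemma trans_regular:
  assumes "line_bundle n X A" "i \<in> idx A" "j \<in> idx A"
  shows "trans_fun A i j \<in> regular_on n X (chart A i \<inter> chart A j)"
  using assms by (auto simp: line_bundle_def)

lemma trans_cocycle: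
  assumes "line_bundle n X A" "i \<in> idx A" "j \<in> idx A" "k \<in> idx A"
    and "P \<in> chart A i" "P \<in> chart A j" "P \<in> chart A k"
  shows "trans_fun A i j P * trans_fun A j k P = trans_fun A i k P"
  using assms by (auto simp: line_bundle_def)

lemma trans_self:
  assumes "line_bundle n X A" "i \<in> idx A" "P \<in> chart A i"
  shows "trans_fun A i i P = 1"
proof -
  have "trans_fun A i i P \<noteq> 0" using assms by (auto simp: line_bundle_def)
  then show ?thesis using trans_cocycle[OF assms(1,2,2,2,3,3,3)] by simp
qed

text \<open>
  A chosen index of a trivialising chart around \<open>P\<close>, used to read germs of sections at \<open>P\<close> as germs
  of functions.
\<close>
definition chart_at :: "('i, 'a::field) lbundle \<Rightarrow> 'a pt \<Rightarrow> 'i" where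
  "chart_at A P = (SOME i. i \<in> idx A \<and> P \<in> chart A i)"

lemma chart_at:
  assumes "line_bundle n X A" "P \<in> X"
  shows "chart_at A P \<in> idx A" "P \<in> chart A (chart_at A P)"
proof -
  have "\<exists>i. i \<in> idx A \<and> P \<in> chart A i" using assms chart_cover by blast
  from someI_ex[OF this]
  show "chart_at A P \<in> idx A" "P \<in> chart A (chart_at A P)" by (auto simp: chart_at_def)
qed

lemma section_regular: "s \<in> sections n X A W \<Longrightarrow> i \<in> idx A \<Longrightarrow> s i \<in> regular_on n X (W \<inter> chart A i)"
  by (simp add: sections_def)

lemma section_trans:
  assumes "s \<in> sections n X A W" "i \<in> idx A" "j \<in> idx A"
    and "P \<in> W" "P \<in> chart A i" "P \<in> chart A j"
  shows "s i P = trans_fun A i j P * s j P"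
proof -
  have "\<forall>i\<in>idx A. \<forall>j\<in>idx A. \<forall>P\<in>W \<inter> chart A i \<inter> chart A j. s i P = trans_fun A i j P * s j P"
    using assms(1) unfolding sections_def by (elim CollectE conjE)
  then show ?thesis using assms(2-) by blast
qed

lemma section_germ:
  assumes "line_bundle n X A" "openin (top_of n X) W" "s \<in> sections n X A W"
    "i \<in> idx A" "P \<in> W" "P \<in> chart A i"
  shows "s i \<in> germs n X P"
  by (rule germsI[OF openin_Int[OF assms(2) chart_open[OF assms(1,4)]] _ section_regular[OF assms(3,4)]])
     (use assms in auto)

lemma section_diff:
  assumes A: "line_bundle n X A" and W: "openin (top_of n X) W" "openin (top_of n X) W'"
    and s: "s \<in> sections n X A W" and t: "t \<in> sections n X A W'"
  shows "(\<lambda>i P. s i P - t i P) \<in> sections n X A (W \<inter> W')"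
  unfolding sections_def
proof (intro CollectI conjI ballI)
  fix i assume i: "i \<in> idx A"
  have o: "openin (top_of n X) (W \<inter> W' \<inter> chart A i)"
    by (intro openin_Int W chart_open[OF A i])
  have "s i \<in> regular_on n X (W \<inter> W' \<inter> chart A i)"
    by (rule regular_on_subset[OF section_regular[OF s i] o]) auto
  moreover have "t i \<in> regular_on n X (W \<inter> W' \<inter> chart A i)"
    by (rule regular_on_subset[OF section_regular[OF t i] o]) auto
  ultimately show "(\<lambda>P. s i P - t i P) \<in> regular_on n X (W \<inter> W' \<inter> chart A i)"
    by (rule regular_on_diff[OF o])
  fix j P assume "j \<in> idx A" "P \<in> W \<inter> W' \<inter> chart A i \<inter> chart A j"
  then show "s i P - t i P = trans_fun A i j P * (s j P - t j P)"
    using section_trans[OF s i, of j P] section_trans[OF t i, of j P] by (simp add: algebra_simps)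
qed

lemma ideal_sections_iff:
  assumes X: "X \<subseteq> proj_space n" and Z: "finite Z" and W: "openin (top_of n X) W"
    and A: "line_bundle n X A"
  shows "d \<in> ideal_sections n X A (frob_power n X (ideal_sheaf n X Z) q) W \<longleftrightarrow>
    d \<in> sections n X A W \<and> (\<forall>i\<in>idx A. \<forall>P\<in>W \<inter> chart A i \<inter> Z.
      d i \<in> germ_ideal n X P (powers q (max_ideal n X P)))"
proof -
  have o: "openin (top_of n X) (W \<inter> chart A i)" if "i \<in> idx A" for i
    by (intro openin_Int W chart_open[OF A that])
  show ?thesis
    by (auto simp: ideal_sections_def frob_power_iff[OF X Z o] section_regular)
qed

text \<open>
  A section of \<open>A\<close> modulo the Frobenius power is determined by one germ at each point of \<open>Z\<close>, and
  these germs can be prescribed independently. So separation of \<open>p\<^sup>e\<close>-Frobenius jets means that every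
  family of germs, one at each \<open>P \<in> Z\<close>, is approximated modulo \<open>m\<^sub>P\<^bsup>[p\<^sup>e]\<^esup>\<close> by one global section.
\<close>
lemma separates_iff_local:
  fixes X Z :: "'a::field pt set"
  assumes X: "X \<subseteq> proj_space n" and Z: "finite Z" "Z \<subseteq> X" and A: "line_bundle n X A"
  shows "separates_frobenius_jets n X A Z e \<longleftrightarrow>
    (\<forall>f. (\<forall>P\<in>Z. f P \<in> germs n X P) \<longrightarrow> (\<exists>s\<in>sections n X A X. \<forall>P\<in>Z.
      (\<lambda>Q. s (chart_at A P) Q - f P Q) \<in>
        germ_ideal n X P (powers (CHAR('a) ^ e) (max_ideal n X P))))"
    (is "?lhs \<longleftrightarrow> ?rhs")
proof -
  define J where "J = frob_power n X (ideal_sheaf n X Z) (CHAR('a) ^ e)"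
  define I where "I P = germ_ideal n X P (powers (CHAR('a) ^ e) (max_ideal n X P))" for P
  note J_iff = ideal_sections_iff[OF X Z(1) _ A, where q = "CHAR('a) ^ e", folded J_def I_def]
  have oX: "openin (top_of n X) X" by (rule openin_self[OF X])
  have lhs: "?lhs \<longleftrightarrow>
      (\<forall>T. quotient_section n X A J T \<longrightarrow> (\<exists>s\<in>sections n X A X. restricts_to n X A J s T))"
    unfolding separates_frobenius_jets_def J_def Let_def by (rule refl)
  define c where "c = chart_at A"
  have c: "c P \<in> idx A" "P \<in> chart A (c P)" if "P \<in> Z" for P
    using chart_at[OF A, of P] that Z by (auto simp: c_def)
  have "?rhs" if sep: ?lhs
  proof (intro allI impI)
    fix f assume f: "\<forall>P\<in>Z. f P \<in> germs n X P"
    then have "\<forall>P\<in>Z. \<exists>V. openin (top_of n X) V \<and> P \<in> V \<and> f P \<in> regular_on n X V"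
      by (simp add: germs_def)
    then obtain V where V: "\<And>P. P \<in> Z \<Longrightarrow> openin (top_of n X) (V P)"
      "\<And>P. P \<in> Z \<Longrightarrow> P \<in> V P" "\<And>P. P \<in> Z \<Longrightarrow> f P \<in> regular_on n X (V P)"
      by metis
    \<comment> \<open>A neighbourhood of \<open>P\<close> that contains no other point of \<open>Z\<close>, so that overlaps avoid \<open>Z\<close>.\<close>
    define W where "W P = V P \<inter> chart A (c P) \<inter> (X - (Z - {P}))" for P
    have W: "openin (top_of n X) (W P)" "P \<in> W P" "W P \<inter> Z \<subseteq> {P}" if "P \<in> Z" for P
    proof -
      show "openin (top_of n X) (W P)" unfolding W_def
        using Z(1) by (intro openin_Int V(1)[OF that] chart_open[OF A c(1)[OF that]]
            openin_diff_finite[OF X]) auto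
      show "P \<in> W P" "W P \<inter> Z \<subseteq> {P}" using V(2) c(2) that Z(2) by (auto simp: W_def)
    qed
    define t where "t P = (\<lambda>i Q. trans_fun A i (c P) Q * f P Q)" for P
    have t: "t P \<in> sections n X A (W P)" if P: "P \<in> Z" for P
      unfolding sections_def
    proof (intro CollectI conjI ballI)
      fix i assume i: "i \<in> idx A"
      have o: "openin (top_of n X) (W P \<inter> chart A i)"
        by (intro openin_Int W P chart_open[OF A i])
      have "trans_fun A i (c P) \<in> regular_on n X (W P \<inter> chart A i)"
        by (rule regular_on_subset[OF trans_regular[OF A i c(1)[OF P]] o]) (auto simp: W_def)
      moreover have "f P \<in> regular_on n X (W P \<inter> chart A i)"
        by (rule regular_on_subset[OF V(3)[OF P] o]) (auto simp: W_def)
      ultimately show "t P i \<in> regular_on n X (W P \<inter> chart A i)"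
        unfolding t_def by (rule regular_on_mult)
      fix j Q assume j: "j \<in> idx A" and Q: "Q \<in> W P \<inter> chart A i \<inter> chart A j"
      have "trans_fun A i j Q * trans_fun A j (c P) Q = trans_fun A i (c P) Q"
        by (rule trans_cocycle[OF A i j c(1)[OF P]]) (use Q in \<open>auto simp: W_def\<close>)
      then show "t P i Q = trans_fun A i j Q * t P j Q"
        by (simp add: t_def flip: mult.assoc)
    qed
    \<comment> \<open>The jet given by \<open>f\<close> near each point of \<open>Z\<close> and by \<open>0\<close> on the complement of \<open>Z\<close>.\<close>
    define T where "T = insert (X - Z, \<lambda>_ _. 0) ((\<lambda>P. (W P, t P)) ` Z)"
    have XZ: "openin (top_of n X) (X - Z)" by (rule openin_diff_finite[OF X Z(1)])
    have T1: "openin (top_of n X) U \<and> u \<in> sections n X A U" if "(U, u) \<in> T" for U u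
    proof -
      have "(\<lambda>_ _. 0) \<in> sections n X A (X - Z)"
        by (auto simp: sections_def intro!: regular_on_const openin_Int XZ chart_open[OF A])
      then show ?thesis using that XZ W(1) t by (auto simp: T_def)
    qed
    have T2: "u = t P" if "(U, u) \<in> T" "P \<in> U \<inter> Z" for U u P
      using that W(3) by (auto simp: T_def)
    have "quotient_section n X A J T"
      unfolding quotient_section_def
    proof (intro conjI)
      show "\<forall>(U, u)\<in>T. openin (top_of n X) U \<and> u \<in> sections n X A U" using T1 by blast
      show "(\<Union>(U, u)\<in>T. U) = X"
      proof (intro equalityI subsetI)
        fix P assume "P \<in> (\<Union>(U, u)\<in>T. U)"
        then obtain U u where "(U, u) \<in> T" "P \<in> U" by blast
        then show "P \<in> X" using openin_imp_subset[OF conjunct1[OF T1]] by blast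
      next
        fix P assume P: "P \<in> X"
        have "(X - Z, \<lambda>_ _. 0) \<in> T" by (simp add: T_def)
        moreover have "(W P, t P) \<in> T" if "P \<in> Z" using that by (simp add: T_def)
        ultimately show "P \<in> (\<Union>(U, u)\<in>T. U)" using P W(2)[of P] by blast
      qed
      show "\<forall>(U, u)\<in>T. \<forall>(U', u')\<in>T. (\<lambda>i Q. u i Q - u' i Q) \<in> ideal_sections n X A J (U \<inter> U')"
      proof (clarify)
        fix U u U' u' assume UT: "(U, u) \<in> T" "(U', u') \<in> T"
        have U: "openin (top_of n X) U" "u \<in> sections n X A U"
          "openin (top_of n X) U'" "u' \<in> sections n X A U'" using T1 UT by auto
        show "(\<lambda>i Q. u i Q - u' i Q) \<in> ideal_sections n X A J (U \<inter> U')"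
          unfolding J_iff[OF openin_Int[OF U(1,3)]]
        proof (intro conjI ballI)
          show "(\<lambda>i Q. u i Q - u' i Q) \<in> sections n X A (U \<inter> U')"
            by (rule section_diff[OF A U(1,3,2,4)])
          fix i P assume P: "P \<in> U \<inter> U' \<inter> chart A i \<inter> Z"
          then have P': "P \<in> U \<inter> Z" "P \<in> U' \<inter> Z" by auto
          have "u = u'" using T2[OF UT(1) P'(1)] T2[OF UT(2) P'(2)] by (rule trans[OF _ sym])
          have PX: "P \<in> X" using P Z by blast
          interpret germ_ring "near n X P" "germs n X P" using X PX by (rule germ_ring_germs)
          show "(\<lambda>Q. u i Q - u' i Q) \<in> I P"
            unfolding I_def \<open>u = u'\<close> by (rule ideal_gen.zero) simp
        qed
      qed
    qed
    then obtain s where s: "s \<in> sections n X A X" "restricts_to n X A J s T"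
      using sep lhs by blast
    show "\<exists>s\<in>sections n X A X. \<forall>P\<in>Z. (\<lambda>Q. s (chart_at A P) Q - f P Q) \<in>
        germ_ideal n X P (powers (CHAR('a) ^ e) (max_ideal n X P))"
      unfolding c_def[symmetric] I_def[symmetric]
    proof (intro bexI[OF _ s(1)] ballI)
      fix P assume P: "P \<in> Z"
      have PX: "P \<in> X" using P Z by blast
      interpret germ_ring "near n X P" "germs n X P" using X PX by (rule germ_ring_germs)
      have "(W P, t P) \<in> T" using P by (simp add: T_def)
      then have "(\<lambda>i Q. s i Q - t P i Q) \<in> ideal_sections n X A J (W P)"
        using s(2) unfolding restricts_to_def by blast
      then have "(\<lambda>Q. s (c P) Q - t P (c P) Q) \<in> I P"
        unfolding J_iff[OF W(1)[OF P]] using c[OF P] W(2)[OF P] P by blast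
      then show "(\<lambda>Q. s (c P) Q - f P Q) \<in> I P"
        unfolding I_def
      proof (rule ideal_gen_cong)
        have "s (c P) Q - t P (c P) Q = s (c P) Q - f P Q" if "Q \<in> W P" for Q
          using trans_self[OF A c(1)[OF P], of Q] that by (simp add: t_def W_def)
        then show "\<forall>\<^sub>F Q in near n X P. s (c P) Q - t P (c P) Q = s (c P) Q - f P Q"
          unfolding eventually_near[OF X PX] using W[OF P] by blast
      qed
    qed
  qed
  moreover have "?lhs" if rhs: ?rhs
    unfolding lhs
  proof (intro allI impI)
    fix T assume T: "quotient_section n X A J T"
    have T1: "openin (top_of n X) U" "u \<in> sections n X A U" if "(U, u) \<in> T" for U u
      using T that by (auto simp: quotient_section_def)
    have "\<exists>U u. (U, u) \<in> T \<and> P \<in> U" if P: "P \<in> Z" for P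
    proof -
      have "P \<in> (\<Union>(U, u)\<in>T. U)" using T P Z(2) by (auto simp: quotient_section_def)
      then show ?thesis by blast
    qed
    then obtain W t where WT: "\<And>P. P \<in> Z \<Longrightarrow> (W P, t P) \<in> T" and W: "\<And>P. P \<in> Z \<Longrightarrow> P \<in> W P"
      by metis
    have "\<forall>P\<in>Z. t P (c P) \<in> germs n X P"
      using section_germ[OF A T1[OF WT] c(1) W c(2)] by blast
    then obtain s where s: "s \<in> sections n X A X"
      "\<And>P. P \<in> Z \<Longrightarrow> (\<lambda>Q. s (c P) Q - t P (c P) Q) \<in> I P"
      using rhs[rule_format, of "\<lambda>P. t P (c P)"] unfolding c_def I_def by blast
    have "restricts_to n X A J s T" unfolding restricts_to_def
    proof (clarify)
      fix U u assume UT: "(U, u) \<in> T"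
      note U = T1[OF UT]
      show "(\<lambda>i Q. s i Q - u i Q) \<in> ideal_sections n X A J U"
        unfolding J_iff[OF U(1)]
      proof (intro conjI ballI)
        have "X \<inter> U = U" using openin_imp_subset[OF U(1)] by blast
        then show "(\<lambda>i Q. s i Q - u i Q) \<in> sections n X A U"
          using section_diff[OF A oX U(1) s(1) U(2)] by simp
        fix i P assume i: "i \<in> idx A" and P: "P \<in> U \<inter> chart A i \<inter> Z"
        then have PZ: "P \<in> Z" and PX: "P \<in> X" using Z by auto
        note cP = c[OF PZ]
        interpret germ_ring "near n X P" "germs n X P" using X PX by (rule germ_ring_germs)
        have "trans_fun A i (c P) \<in> germs n X P"
          by (rule germsI[OF openin_Int[OF chart_open[OF A i] chart_open[OF A cP(1)]] _
                trans_regular[OF A i cP(1)]]) (use P cP in auto)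
        then have 1: "(\<lambda>Q. trans_fun A i (c P) Q * (s (c P) Q - t P (c P) Q)) \<in> I P"
          using s(2)[OF PZ] unfolding I_def by (rule ideal_gen_mult)
        have 2: "(\<lambda>Q. t P i Q - u i Q) \<in> I P"
        proof -
          have "(\<lambda>i Q. t P i Q - u i Q) \<in> ideal_sections n X A J (W P \<inter> U)"
            using T WT[OF PZ] UT unfolding quotient_section_def by blast
          then show ?thesis
            unfolding J_iff[OF openin_Int[OF T1(1)[OF WT[OF PZ]] U(1)]] using i P W[OF PZ] by blast
        qed
        \<comment> \<open>Passing from the chosen chart at \<open>P\<close> to the \<open>i\<close>-th one multiplies by a transition function.\<close>
        from 1 2 have "(\<lambda>Q. trans_fun A i (c P) Q * (s (c P) Q - t P (c P) Q) +
            (t P i Q - u i Q)) \<in> I P" unfolding I_def by (rule ideal_gen_add)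
        then show "(\<lambda>Q. s i Q - u i Q) \<in> I P" unfolding I_def
        proof (rule ideal_gen_cong)
          define V where "V = W P \<inter> (chart A i \<inter> chart A (c P))"
          have V: "openin (top_of n X) V"
            unfolding V_def by (intro openin_Int T1(1)[OF WT[OF PZ]] chart_open[OF A] i cP)
          have PV: "P \<in> V" using W[OF PZ] P cP by (auto simp: V_def)
          have "trans_fun A i (c P) Q * (s (c P) Q - t P (c P) Q) + (t P i Q - u i Q) = s i Q - u i Q"
            if Q: "Q \<in> V" for Q
          proof -
            have QX: "Q \<in> X" using Q openin_imp_subset[OF V] by blast
            have "s i Q = trans_fun A i (c P) Q * s (c P) Q"
              by (rule section_trans[OF s(1) i cP(1) QX]) (use Q in \<open>auto simp: V_def\<close>)
            moreover have "t P i Q = trans_fun A i (c P) Q * t P (c P) Q"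
              by (rule section_trans[OF T1(2)[OF WT[OF PZ]] i cP(1)]) (use Q in \<open>auto simp: V_def\<close>)
            ultimately show ?thesis by (simp only: right_diff_distrib) simp
          qed
          then show "\<forall>\<^sub>F Q in near n X P.
              trans_fun A i (c P) Q * (s (c P) Q - t P (c P) Q) + (t P i Q - u i Q) = s i Q - u i Q"
            unfolding eventually_near[OF X PX] using V PV by blast
        qed
      qed
    qed
    then show "\<exists>s\<in>sections n X A X. restricts_to n X A J s T" using s(1) by blast
  qed
  ultimately show ?thesis by blast
qed

section \<open>Sections of tensor powers and Frobenius jets\<close>

lemma tensor_power_simps [simp]:
  "idx (tensor_power L m) = idx L" "chart (tensor_power L m) = chart L"
  "trans_fun (tensor_power L m) = (\<lambda>i j P. trans_fun L i j P ^ m)"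
  by (simp_all add: tensor_power_def)

lemma tensor_power_tensor_power: "tensor_power (tensor_power L r) m = tensor_power L (r * m)"
  by (simp add: tensor_power_def power_mult)

lemma chart_at_tensor_power [simp]: "chart_at (tensor_power L m) P = chart_at L P"
  by (simp add: chart_at_def)

lemma line_bundle_tensor_power:
  assumes L: "line_bundle n X L" shows "line_bundle n X (tensor_power L m)"
  unfolding line_bundle_def tensor_power_simps
proof (intro conjI ballI)
  fix i j assume ij: "i \<in> idx L" "j \<in> idx L"
  have o: "openin (top_of n X) (chart L i \<inter> chart L j)"
    by (intro openin_Int chart_open[OF L] ij)
  show "(\<lambda>P. trans_fun L i j P ^ m) \<in> regular_on n X (chart L i \<inter> chart L j)"
    by (rule regular_on_power[OF o trans_regular[OF L ij]])
  fix P assume "P \<in> chart L i \<inter> chart L j"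
  then show "trans_fun L i j P ^ m \<noteq> 0" using L ij by (auto simp: line_bundle_def)
next
  fix i j k P assume "i \<in> idx L" "j \<in> idx L" "k \<in> idx L" "P \<in> chart L i \<inter> chart L j \<inter> chart L k"
  then show "trans_fun L i j P ^ m * trans_fun L j k P ^ m = trans_fun L i k P ^ m"
    using trans_cocycle[OF L, of i j k P] by (simp flip: power_mult_distrib)
qed (use L chart_open[OF L] in \<open>auto simp: line_bundle_def\<close>)

text \<open>
  A line bundle \<open>L\<close> and a finite set \<open>Z\<close> of points on \<open>X\<close>, in positive characteristic.
\<close>
locale jet_data =
  fixes n :: nat and X Z :: "'a::field pt set" and L :: "('i, 'a) lbundle"
  assumes X: "X \<subseteq> proj_space n" and Z: "finite Z" "Z \<subseteq> X" and L: "line_bundle n X L"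
    and char_pos: "CHAR('a) > 0"
begin

abbreviation sect :: "nat \<Rightarrow> ('i \<Rightarrow> 'a pt \<Rightarrow> 'a) set" where
  "sect m \<equiv> sections n X (tensor_power L m) X"

abbreviation M :: "'a pt \<Rightarrow> ('a pt \<Rightarrow> 'a) set" where
  "M P \<equiv> max_ideal n X P"

text \<open>
  The Frobenius power \<open>m\<^sub>P\<^bsup>[q]\<^esup>\<close> in the local ring at \<open>P\<close>.
\<close>
abbreviation frob :: "nat \<Rightarrow> 'a pt \<Rightarrow> ('a pt \<Rightarrow> 'a) set" where
  "frob q P \<equiv> germ_ideal n X P (powers q (M P))"

abbreviation sep :: "nat \<Rightarrow> nat \<Rightarrow> bool" where
  "sep m e \<equiv> separates_frobenius_jets n X (tensor_power L m) Z e"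

text \<open>
  The germ of a section of a power of \<open>L\<close> at \<open>P\<close>, read in the chosen chart around \<open>P\<close>. All powers of
  \<open>L\<close> have the same charts, so this does not depend on the exponent.
\<close>
definition at_pt :: "('i \<Rightarrow> 'a pt \<Rightarrow> 'a) \<Rightarrow> 'a pt \<Rightarrow> 'a pt \<Rightarrow> 'a" where
  "at_pt s P = s (chart_at L P)"

lemma prime_char: "prime CHAR('a)"
  using prime_CHAR_semidom[OF char_pos] .

lemma ring: "P \<in> Z \<Longrightarrow> germ_ring (germs n X P)"
  using germ_ring_germs[OF X] Z by blast

lemma sep_iff:
  "sep m e \<longleftrightarrow> (\<forall>f. (\<forall>P\<in>Z. f P \<in> germs n X P) \<longrightarrow>
    (\<exists>s\<in>sect m. \<forall>P\<in>Z. (\<lambda>Q. at_pt s P Q - f P Q) \<in> frob (CHAR('a) ^ e) P))"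
  unfolding separates_iff_local[OF X Z line_bundle_tensor_power[OF L]] chart_at_tensor_power
    at_pt_def by (rule refl)

lemma sepD:
  assumes "sep m e" "\<And>P. P \<in> Z \<Longrightarrow> f P \<in> germs n X P"
  obtains s where "s \<in> sect m" "\<forall>P\<in>Z. (\<lambda>Q. at_pt s P Q - f P Q) \<in> frob (CHAR('a) ^ e) P"
  using assms unfolding sep_iff by blast

lemma sect_germ:
  assumes "s \<in> sect m" "P \<in> Z" shows "at_pt s P \<in> germs n X P"
proof -
  have PX: "P \<in> X" using assms(2) Z(2) by blast
  show ?thesis
    unfolding at_pt_def
    by (rule section_germ[OF line_bundle_tensor_power[OF L] openin_self[OF X] assms(1) _ PX])
       (simp_all add: chart_at[OF L PX])
qed

lemma sectI:
  assumes "\<And>i. i \<in> idx L \<Longrightarrow> s i \<in> regular_on n X (X \<inter> chart L i)"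
    and "\<And>i j P. i \<in> idx L \<Longrightarrow> j \<in> idx L \<Longrightarrow> P \<in> X \<Longrightarrow> P \<in> chart L i \<Longrightarrow> P \<in> chart L j \<Longrightarrow>
      s i P = trans_fun L i j P ^ m * s j P"
  shows "s \<in> sect m"
  unfolding sections_def tensor_power_simps
  by (intro CollectI conjI ballI assms(1), assumption, rule assms(2)) blast+

lemma sect_regular: "s \<in> sect m \<Longrightarrow> i \<in> idx L \<Longrightarrow> s i \<in> regular_on n X (X \<inter> chart L i)"
  using section_regular[of s n X "tensor_power L m" X i] by simp

lemma sect_trans:
  "s \<in> sect m \<Longrightarrow> i \<in> idx L \<Longrightarrow> j \<in> idx L \<Longrightarrow> P \<in> X \<Longrightarrow> P \<in> chart L i \<Longrightarrow> P \<in> chart L j \<Longrightarrow>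
    s i P = trans_fun L i j P ^ m * s j P"
  using section_trans[of s n X "tensor_power L m" X i j P] unfolding tensor_power_simps .

lemma sect_const:
  assumes "c = 0 \<or> c = 1 \<and> m = 0" shows "(\<lambda>_ _. c) \<in> sect m"
proof (rule sectI)
  fix i assume "i \<in> idx L"
  then show "(\<lambda>_. c) \<in> regular_on n X (X \<inter> chart L i)"
    by (intro regular_on_const openin_Int openin_self[OF X] chart_open[OF L])
qed (use assms in auto)

lemma sect_add:
  assumes s: "s \<in> sect m" and t: "t \<in> sect m" shows "(\<lambda>i P. s i P + t i P) \<in> sect m"
proof (rule sectI)
  fix i j P assume "i \<in> idx L" "j \<in> idx L" "P \<in> X" "P \<in> chart L i" "P \<in> chart L j"
  from sect_trans[OF s this] sect_trans[OF t this]
  show "s i P + t i P = trans_fun L i j P ^ m * (s j P + t j P)"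
    by (simp only: distrib_left)
qed (intro regular_on_add sect_regular[OF s] sect_regular[OF t])

lemma sect_mult:
  assumes s: "s \<in> sect a" and t: "t \<in> sect b" shows "(\<lambda>i P. s i P * t i P) \<in> sect (a + b)"
proof (rule sectI)
  fix i j P assume "i \<in> idx L" "j \<in> idx L" "P \<in> X" "P \<in> chart L i" "P \<in> chart L j"
  from sect_trans[OF s this] sect_trans[OF t this]
  show "s i P * t i P = trans_fun L i j P ^ (a + b) * (s j P * t j P)"
    by (simp only: power_add mult_ac)
qed (intro regular_on_mult sect_regular[OF s] sect_regular[OF t])

lemma sect_power:
  assumes t: "t \<in> sect b" shows "(\<lambda>i P. t i P ^ k) \<in> sect (k * b)"
proof (induction k)
  case 0
  then show ?case by (simp add: sect_const)
next
  case (Suc k)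
  from sect_mult[OF t Suc] show ?case by simp
qed

lemma frob_eval:
  assumes "P \<in> Z" "q > 0" "f \<in> frob q P" shows "f P = 0"
proof -
  have PX: "P \<in> X" using assms Z by blast
  interpret germ_ring "near n X P" "germs n X P" by (rule ring[OF assms(1)])
  from assms(3) show ?thesis
  proof induction
    case (zero f)
    then show ?case unfolding eventually_near[OF X PX] by blast
  next
    case (step f a g h)
    have "h P = f P + a P * g P"
      using step.hyps(4) unfolding eventually_near[OF X PX] by blast
    moreover have "g P = 0"
      using step.hyps(3) assms(2) by (auto simp: powers_def max_ideal_def)
    ultimately show ?case using step.IH by simp
  qed
qed

lemma sep_unit_section:
  assumes "sep m e"
  obtains s where "s \<in> sect m" "\<And>P. P \<in> Z \<Longrightarrow> at_pt s P P = 1"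
proof -
  have "(\<lambda>_. 1) \<in> germs n X P" if "P \<in> Z" for P
    using germ_ring.const[OF ring[OF that]] .
  then obtain s where s: "s \<in> sect m" "\<forall>P\<in>Z. (\<lambda>Q. at_pt s P Q - 1) \<in> frob (CHAR('a) ^ e) P"
    by (rule sepD[OF assms])
  have "at_pt s P P = 1" if "P \<in> Z" for P
    using frob_eval[OF that _ bspec[OF s(2) that]] char_pos by simp
  with s(1) show thesis by (rule that)
qed

text \<open>
  To approximate \<open>f\<close> by a section of the product, approximate \<open>f / u\<close> and multiply by \<open>u\<close>.
\<close>
lemma sep_mult_unit_section:
  assumes "sep m e" and u: "u \<in> sect m'" "\<And>P. P \<in> Z \<Longrightarrow> at_pt u P P \<noteq> 0"
  shows "sep (m + m') e"
  unfolding sep_iff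
proof (intro allI impI)
  fix f assume f: "\<forall>P\<in>Z. f P \<in> germs n X P"
  have inv: "(\<lambda>Q. inverse (at_pt u P Q)) \<in> germs n X P"
    "\<forall>\<^sub>F Q in near n X P. at_pt u P Q \<noteq> 0" if "P \<in> Z" for P
    using germs_inverse[OF X _ sect_germ[OF u(1) that] u(2)[OF that]] that Z by auto
  have "(\<lambda>Q. inverse (at_pt u P Q) * f P Q) \<in> germs n X P" if "P \<in> Z" for P
    using germ_ring.mult[OF ring[OF that] inv(1)[OF that]] f that by blast
  then obtain s where s: "s \<in> sect m"
    "\<forall>P\<in>Z. (\<lambda>Q. at_pt s P Q - inverse (at_pt u P Q) * f P Q) \<in> frob (CHAR('a) ^ e) P"
    by (rule sepD[OF assms(1)])
  show "\<exists>s\<in>sect (m + m'). \<forall>P\<in>Z. (\<lambda>Q. at_pt s P Q - f P Q) \<in> frob (CHAR('a) ^ e) P"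
  proof (intro bexI[OF _ sect_mult[OF s(1) u(1)]] ballI)
    fix P assume P: "P \<in> Z"
    interpret germ_ring "near n X P" "germs n X P" by (rule ring[OF P])
    from sect_germ[OF u(1) P] bspec[OF s(2) P]
    have "(\<lambda>Q. at_pt u P Q * (at_pt s P Q - inverse (at_pt u P Q) * f P Q)) \<in> frob (CHAR('a) ^ e) P"
      by (rule ideal_gen_mult)
    then show "(\<lambda>Q. at_pt (\<lambda>i P. s i P * u i P) P Q - f P Q) \<in> frob (CHAR('a) ^ e) P"
      by (rule ideal_gen_cong)
        (use inv(2)[OF P] in eventually_elim, simp add: at_pt_def field_simps)
  qed
qed

lemma sep_add_unit_multiple:
  assumes "sep m e" and u: "u \<in> sect m'" "\<And>P. P \<in> Z \<Longrightarrow> at_pt u P P \<noteq> 0"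
  shows "sep (m + j * m') e"
proof (induction j)
  case (Suc j)
  have "sep (m + j * m' + m') e" by (rule sep_mult_unit_section[OF Suc u])
  then show ?case by (simp add: algebra_simps)
qed (simp add: assms(1))

lemma products_subset_frob:
  assumes P: "P \<in> Z"
  shows "powers (CHAR('a) ^ e) (products (Suc n * q) (M P)) \<subseteq> frob (CHAR('a) ^ e * q) P"
proof -
  have PX: "P \<in> X" using P Z by blast
  interpret germ_ring "near n X P" "germs n X P" by (rule ring[OF P])
  obtain u where "\<And>i. i \<le> n \<Longrightarrow> u i \<in> M P" "M P \<subseteq> ideal_gen (u ` {..n})"
    by (rule max_ideal_finitely_generated[OF X PX]) (rule that)
  moreover have "M P \<subseteq> germs n X P" by (auto simp: max_ideal_def)
  ultimately have *: "products (Suc n * q) (M P) \<subseteq> frob q P"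
    using products_subset_ideal_gen_powers[of "M P" u n q "Suc n * q"] by blast
  show ?thesis
  proof
    fix f assume "f \<in> powers (CHAR('a) ^ e) (products (Suc n * q) (M P))"
    then obtain g where g: "g \<in> frob q P" "f = (\<lambda>Q. g Q ^ CHAR('a) ^ e)"
      using * by (auto simp: powers_def)
    then show "f \<in> frob (CHAR('a) ^ e * q) P"
      using powers_ideal_gen[OF prime_char g(1), of e] by (simp add: powers_powers mult.commute)
  qed
qed

section \<open>Separation of jets is additive along Frobenius twists\<close>

text \<open>
  The ideal \<open>(m\<^sub>P\<^sup>N)\<^bsup>[q]\<^esup> + m\<^sub>P\<^bsup>[q q']\<^esup>\<close>, which decreases to \<open>m\<^sub>P\<^bsup>[q q']\<^esup>\<close> as \<open>N\<close> grows.
\<close>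
definition mixed :: "nat \<Rightarrow> nat \<Rightarrow> nat \<Rightarrow> 'a pt \<Rightarrow> ('a pt \<Rightarrow> 'a) set" where
  "mixed q q' N P = germ_ideal n X P (powers q (products N (M P)) \<union> powers (q * q') (M P))"

text \<open>
  Some section of \<open>L\<^sup>c\<close> agrees with the family of germs \<open>f\<close> modulo the ideals \<open>mixed q q' N\<close> at all
  points of \<open>Z\<close>.
\<close>
definition approximable :: "nat \<Rightarrow> nat \<Rightarrow> nat \<Rightarrow> nat \<Rightarrow> ('a pt \<Rightarrow> 'a pt \<Rightarrow> 'a) \<Rightarrow> bool" where
  "approximable c q q' N f \<longleftrightarrow>
     (\<exists>s\<in>sect c. \<forall>P\<in>Z. (\<lambda>Q. at_pt s P Q - f P Q) \<in> mixed q q' N P)"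

lemma approximable_zero:
  assumes "\<And>P. P \<in> Z \<Longrightarrow> f P \<in> mixed q q' N P"
  shows "approximable c q q' N f"
  unfolding approximable_def
proof (intro bexI[OF _ sect_const] ballI)
  fix P assume P: "P \<in> Z"
  interpret germ_ring "near n X P" "germs n X P" by (rule ring[OF P])
  show "(\<lambda>Q. at_pt (\<lambda>_ _. 0) P Q - f P Q) \<in> mixed q q' N P"
    using ideal_gen_mult[OF const[of "-1"] assms[OF P, unfolded mixed_def]]
    by (simp add: at_pt_def mixed_def)
qed simp

lemma approximable_add:
  assumes "approximable c q q' N f" "approximable c q q' N g"
    and h: "\<And>P. P \<in> Z \<Longrightarrow> \<forall>\<^sub>F Q in near n X P. h P Q = f P Q + g P Q"
  shows "approximable c q q' N h"
proof -
  obtain s t where s: "s \<in> sect c" "\<forall>P\<in>Z. (\<lambda>Q. at_pt s P Q - f P Q) \<in> mixed q q' N P"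
    and t: "t \<in> sect c" "\<forall>P\<in>Z. (\<lambda>Q. at_pt t P Q - g P Q) \<in> mixed q q' N P"
    using assms(1,2) unfolding approximable_def by blast
  show ?thesis unfolding approximable_def
  proof (intro bexI[OF _ sect_add[OF s(1) t(1)]] ballI)
    fix P assume P: "P \<in> Z"
    interpret germ_ring "near n X P" "germs n X P" by (rule ring[OF P])
    have "(\<lambda>Q. (at_pt s P Q - f P Q) + (at_pt t P Q - g P Q)) \<in> mixed q q' N P"
      using bspec[OF s(2) P] bspec[OF t(2) P] unfolding mixed_def by (rule ideal_gen_add)
    then show "(\<lambda>Q. at_pt (\<lambda>i P. s i P + t i P) P Q - h P Q) \<in> mixed q q' N P"
      unfolding mixed_def
      by (rule ideal_gen_cong) (use h[OF P] in eventually_elim, simp add: at_pt_def)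
  qed
qed

text \<open>
  The key step. Let \<open>s\<close> approximate \<open>x\<close> modulo \<open>m\<^bsup>[q]\<^esup>\<close> and let \<open>t = y + d\<close> with \<open>d \<in> m\<^bsup>[q']\<^esup>\<close>. Then
  \<open>s t\<^sup>q - x y\<^sup>q = (s - x) y\<^sup>q + s d\<^sup>q\<close>, where the first term lies in \<open>(m\<^bsup>N + 1\<^esup>)\<^bsup>[q]\<^esup>\<close> and the second
  one in \<open>m\<^bsup>[q q']\<^esup>\<close>. At the other points both \<open>s\<close> and \<open>t\<close> approximate \<open>0\<close>.
\<close>
lemma approximable_product:
  assumes a: "sep a e" and b: "sep b e'" and P0: "P0 \<in> Z" and x: "x \<in> germs n X P0"
    and y: "y \<in> products N (M P0)"
  defines "q \<equiv> CHAR('a) ^ e" and "q' \<equiv> CHAR('a) ^ e'"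
  shows "approximable (a + q * b) q q' (Suc N)
    (\<lambda>P. if P = P0 then (\<lambda>Q. x Q * y Q ^ q) else (\<lambda>_. 0))"
proof -
  have zero: "(\<lambda>_. 0) \<in> germs n X P" if "P \<in> Z" for P
    using germ_ring.const[OF ring[OF that]] .
  have yR: "y \<in> germs n X P0"
    using germ_ring.products_in[OF ring[OF P0] _ y] by (auto simp: max_ideal_def)
  have "(if P = P0 then x else (\<lambda>_. 0)) \<in> germs n X P" if "P \<in> Z" for P
    using zero[OF that] x by auto
  then obtain s where s: "s \<in> sect a"
    "\<forall>P\<in>Z. (\<lambda>Q. at_pt s P Q - (if P = P0 then x else (\<lambda>_. 0)) Q) \<in> frob q P"
    unfolding q_def by (rule sepD[OF a])
  have "(if P = P0 then y else (\<lambda>_. 0)) \<in> germs n X P" if "P \<in> Z" for P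
    using zero[OF that] yR by auto
  then obtain t where t: "t \<in> sect b"
    "\<forall>P\<in>Z. (\<lambda>Q. at_pt t P Q - (if P = P0 then y else (\<lambda>_. 0)) Q) \<in> frob q' P"
    unfolding q'_def by (rule sepD[OF b])
  show ?thesis unfolding approximable_def
  proof (intro bexI[OF _ sect_mult[OF s(1) sect_power[OF t(1), of q]]] ballI)
    fix P assume P: "P \<in> Z"
    interpret germ_ring "near n X P" "germs n X P" by (rule ring[OF P])
    define d where "d Q = at_pt t P Q - (if P = P0 then y else (\<lambda>_. 0)) Q" for Q
    have "d \<in> ideal_gen (powers q' (M P))" using bspec[OF t(2) P] unfolding d_def .
    from powers_ideal_gen[OF prime_char this, of e]
    have d: "(\<lambda>Q. d Q ^ q) \<in> mixed q q' (Suc N) P"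
      using ideal_gen_mono[of "powers (q * q') (M P)"
        "powers q (products (Suc N) (M P)) \<union> powers (q * q') (M P)"]
      unfolding mixed_def q_def[symmetric] powers_powers by (auto simp: mult.commute)
    have sR: "at_pt s P \<in> germs n X P" by (rule sect_germ[OF s(1) P])
    show "(\<lambda>Q. at_pt (\<lambda>i P. s i P * t i P ^ q) P Q -
        (if P = P0 then (\<lambda>Q. x Q * y Q ^ q) else (\<lambda>_. 0)) Q) \<in> mixed q q' (Suc N) P"
    proof (cases "P = P0")
      case False
      have "(\<lambda>Q. at_pt s P Q * d Q ^ q) \<in> mixed q q' (Suc N) P"
        using sR d unfolding mixed_def by (rule ideal_gen_mult)
      with False show ?thesis by (simp add: d_def at_pt_def)
    next
      case True
      define r where "r Q = at_pt s P Q - x Q" for Q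
      have r: "r \<in> ideal_gen (powers q (M P))" using bspec[OF s(2) P] True by (simp add: r_def [abs_def])
      have "(\<lambda>Q. r Q * y Q ^ q) \<in> ideal_gen (powers q (products (Suc N) (M P)))"
      proof (rule ideal_gen_prod[OF r])
        show "(\<lambda>Q. y Q ^ q) \<in> ideal_gen (powers q (products N (M P)))"
          using y True by (intro ideal_gen_base powersI) simp
        fix g k assume "g \<in> powers q (M P)" "k \<in> powers q (products N (M P))"
        then obtain g' k' where gk: "g' \<in> M P" "k' \<in> products N (M P)"
          "g = (\<lambda>Q. g' Q ^ q)" "k = (\<lambda>Q. k' Q ^ q)" by (auto simp: powers_def)
        then have "(\<lambda>Q. g' Q * k' Q) \<in> products (Suc N) (M P)" by auto
        from ideal_gen_base[OF powersI[OF this, of q]]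
        show "(\<lambda>Q. g Q * k Q) \<in> ideal_gen (powers q (products (Suc N) (M P)))"
          by (simp only: gk(3,4) power_mult_distrib)
      qed
      then have 1: "(\<lambda>Q. r Q * y Q ^ q) \<in> mixed q q' (Suc N) P"
        unfolding mixed_def using ideal_gen_mono[OF Un_upper1] by blast
      have 2: "(\<lambda>Q. at_pt s P Q * d Q ^ q) \<in> mixed q q' (Suc N) P"
        using sR d unfolding mixed_def by (rule ideal_gen_mult)
      have "(\<lambda>Q. r Q * y Q ^ q + at_pt s P Q * d Q ^ q) \<in> mixed q q' (Suc N) P"
        using 1 2 unfolding mixed_def by (rule ideal_gen_add)
      moreover have "at_pt s P Q * at_pt t P Q ^ q - x Q * y Q ^ q =
          r Q * y Q ^ q + at_pt s P Q * d Q ^ q" for Q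
      proof -
        have "at_pt t P Q = y Q + d Q" using True by (simp add: d_def)
        then have "at_pt t P Q ^ q = y Q ^ q + d Q ^ q"
          by (simp only: freshmans_dream'[OF prime_char q_def[THEN meta_eq_to_obj_eq]])
        then show ?thesis by (simp add: r_def algebra_simps)
      qed
      ultimately show ?thesis using True by (simp add: at_pt_def)
    qed
  qed
qed

text \<open>
  An error term at level \<open>N\<close>, concentrated at one point, can be corrected at level \<open>N + 1\<close>.
\<close>
lemma approximable_mixed:
  assumes a: "sep a e" and b: "sep b e'" and P0: "P0 \<in> Z"
  defines "q \<equiv> CHAR('a) ^ e" and "q' \<equiv> CHAR('a) ^ e'"
  assumes h: "h \<in> mixed q q' N P0"
  shows "approximable (a + q * b) q q' (Suc N) (\<lambda>P. if P = P0 then h else (\<lambda>_. 0))"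
proof -
  interpret germ_ring "near n X P0" "germs n X P0" by (rule ring[OF P0])
  have zero_mixed: "(\<lambda>_. 0) \<in> mixed q q' (Suc N) P" if "P \<in> Z" for P
    unfolding mixed_def by (rule germ_ring.ideal_gen.zero[OF ring[OF that]]) simp
  from h show ?thesis unfolding mixed_def
  proof induction
    case (zero f)
    then have "f \<in> mixed q q' (Suc N) P0" unfolding mixed_def by (rule ideal_gen.zero)
    then show ?case using zero_mixed by (intro approximable_zero) auto
  next
    case (step f x g h)
    have "approximable (a + q * b) q q' (Suc N)
        (\<lambda>P. if P = P0 then (\<lambda>Q. x Q * g Q) else (\<lambda>_. 0))"
    proof (cases "g \<in> powers (q * q') (M P0)")
      case True
      then have "(\<lambda>Q. x Q * g Q) \<in> mixed q q' (Suc N) P0"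
        unfolding mixed_def by (intro ideal_gen_mult step.hyps(2) ideal_gen_base) blast
      then show ?thesis using zero_mixed by (intro approximable_zero) auto
    next
      case False
      then obtain y where y: "y \<in> products N (M P0)" "g = (\<lambda>Q. y Q ^ q)"
        using step.hyps(3) by (auto simp: powers_def)
      show ?thesis unfolding y(2) q_def q'_def
        by (rule approximable_product[OF a b P0 step.hyps(2) y(1)])
    qed
    with step.IH show ?case
    proof (rule approximable_add)
      fix P assume "P \<in> Z"
      show "\<forall>\<^sub>F Q in near n X P. (if P = P0 then h else (\<lambda>_. 0)) Q =
          (if P = P0 then f else (\<lambda>_. 0)) Q + (if P = P0 then (\<lambda>Q. x Q * g Q) else (\<lambda>_. 0)) Q"
        using step.hyps(4) by (cases "P = P0") auto
    qed
  qed
qed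

text \<open>
  At level \<open>0\<close> the ideals are trivial. Each further level is reached by correcting the error of the
  previous one, point by point.
\<close>
lemma approximable_all:
  assumes a: "sep a e" and b: "sep b e'"
    and f: "\<And>P. P \<in> Z \<Longrightarrow> f P \<in> germs n X P"
  defines "q \<equiv> CHAR('a) ^ e" and "q' \<equiv> CHAR('a) ^ e'"
  shows "approximable (a + q * b) q q' N f"
proof (induction N)
  case 0
  have "f P \<in> mixed q q' 0 P" if P: "P \<in> Z" for P
  proof -
    interpret germ_ring "near n X P" "germs n X P" by (rule ring[OF P])
    have "(\<lambda>_. 1) \<in> powers q (products 0 (M P))" by (simp add: powers_def)
    then have "(\<lambda>_. 1) \<in> mixed q q' 0 P" unfolding mixed_def by (intro ideal_gen_base) blast
    from ideal_gen_mult[OF f[OF P] this[unfolded mixed_def]] show ?thesis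
      by (simp add: mixed_def)
  qed
  then show ?case by (rule approximable_zero)
next
  case (Suc N)
  then obtain s where s: "s \<in> sect (a + q * b)"
    "\<forall>P\<in>Z. (\<lambda>Q. at_pt s P Q - f P Q) \<in> mixed q q' N P"
    unfolding approximable_def by blast
  define h where "h P = (\<lambda>Q. f P Q - at_pt s P Q)" for P
  have zero_mixed: "(\<lambda>_. 0) \<in> mixed q q' (Suc N) P" if "P \<in> Z" for P
    unfolding mixed_def by (rule germ_ring.ideal_gen.zero[OF ring[OF that]]) simp
  have h: "h P \<in> mixed q q' N P" if P: "P \<in> Z" for P
  proof -
    interpret germ_ring "near n X P" "germs n X P" by (rule ring[OF P])
    from ideal_gen_mult[OF const[of "-1"] bspec[OF s(2) P, unfolded mixed_def]] show ?thesis
      by (simp add: mixed_def h_def)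
  qed
  have part: "approximable (a + q * b) q q' (Suc N) (\<lambda>P. if P \<in> S then h P else (\<lambda>_. 0))"
    if "finite S" "S \<subseteq> Z" for S
    using that
  proof (induction S rule: finite_induct)
    case empty
    then show ?case using zero_mixed by (intro approximable_zero) auto
  next
    case (insert P0 S)
    have P0: "P0 \<in> Z" using insert by simp
    have "approximable (a + q * b) q q' (Suc N) (\<lambda>P. if P = P0 then h P0 else (\<lambda>_. 0))"
      using approximable_mixed[OF a b P0] h[OF P0] unfolding q_def q'_def by blast
    moreover have "approximable (a + q * b) q q' (Suc N) (\<lambda>P. if P \<in> S then h P else (\<lambda>_. 0))"
      using insert by simp
    ultimately show ?case
      by (rule approximable_add) (use insert.hyps(2) in auto)
  qed
  have h_appr: "approximable (a + q * b) q q' (Suc N) h"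
    by (rule approximable_add[OF part[OF Z(1) order_refl] part[of "{}"]]) auto
  have s_appr: "approximable (a + q * b) q q' (Suc N) (at_pt s)"
    unfolding approximable_def using zero_mixed by (intro bexI[OF _ s(1)]) auto
  show ?case by (rule approximable_add[OF s_appr h_appr]) (simp add: h_def)
qed

lemma sep_add:
  assumes "sep a e" "sep b e'"
  shows "sep (a + CHAR('a) ^ e * b) (e + e')"
  unfolding sep_iff
proof (intro allI impI)
  let ?q = "CHAR('a) ^ e" and ?q' = "CHAR('a) ^ e'" and ?N = "Suc n * CHAR('a) ^ e'"
  fix f assume "\<forall>P\<in>Z. f P \<in> germs n X P"
  then have "approximable (a + ?q * b) ?q ?q' ?N f"
    by (intro approximable_all[OF assms]) blast
  then obtain s where s: "s \<in> sect (a + ?q * b)"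
    "\<forall>P\<in>Z. (\<lambda>Q. at_pt s P Q - f P Q) \<in> mixed ?q ?q' ?N P"
    unfolding approximable_def by blast
  show "\<exists>s\<in>sect (a + ?q * b). \<forall>P\<in>Z. (\<lambda>Q. at_pt s P Q - f P Q) \<in> frob (CHAR('a) ^ (e + e')) P"
  proof (intro bexI[OF _ s(1)] ballI)
    fix P assume P: "P \<in> Z"
    interpret germ_ring "near n X P" "germs n X P" by (rule ring[OF P])
    have "powers ?q (products ?N (M P)) \<union> powers (?q * ?q') (M P) \<subseteq> frob (?q * ?q') P"
      using products_subset_frob[OF P, of e ?q'] ideal_gen_base by blast
    then have "mixed ?q ?q' ?N P \<subseteq> frob (?q * ?q') P"
      unfolding mixed_def by (rule ideal_gen_least)
    then show "(\<lambda>Q. at_pt s P Q - f P Q) \<in> frob (CHAR('a) ^ (e + e')) P"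
      using bspec[OF s(2) P] by (auto simp: power_add)
  qed
qed

end

section \<open>Homogeneity of the Frobenius-Seshadri constant\<close>

lemma (in jet_data) sep_iterate:
  assumes e: "sep m e"
  shows "sep (m * (\<Sum>i\<le>k. CHAR('a) ^ (e * i))) (e * Suc k)"
proof (induction k)
  case 0
  then show ?case using e by simp
next
  case (Suc k)
  have "m + CHAR('a) ^ e * (m * (\<Sum>i\<le>k. CHAR('a) ^ (e * i))) = m * (\<Sum>i\<le>Suc k. CHAR('a) ^ (e * i))"
    unfolding sum.atMost_Suc_shift by (simp add: sum_distrib_left algebra_simps power_add)
  with sep_add[OF e Suc] show ?case by (simp add: algebra_simps)
qed

text \<open>
  The number \<open>p\<^sup>s - 1\<close>, extended to \<open>s = \<infinity>\<close>.
\<close>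
definition sF_value :: "nat \<Rightarrow> enat \<Rightarrow> ereal" where
  "sF_value p s = (case s of enat e \<Rightarrow> ereal (real p ^ e - 1) | \<infinity> \<Rightarrow> \<infinity>)"

lemma sF_value_mono:
  assumes "p \<ge> 1" "s \<le> t" shows "sF_value p s \<le> sF_value p t"
proof (cases t)
  case (enat e)
  then obtain d where "s = enat d" "d \<le> e" using assms(2) by (cases s) auto
  then show ?thesis using enat assms(1) by (simp add: sF_value_def power_increasing)
qed (simp add: sF_value_def)

lemma eps_F_alt:
  fixes L :: "('i, 'a::field) lbundle"
  shows "eps_F n X L Z =
    (SUP m\<in>{1..}. sF_value CHAR('a) (s_F n X (tensor_power L m) Z) / ereal (real m))"
  unfolding eps_F_def sF_value_def by (intro SUP_cong refl) (auto split: enat.split)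

lemma sF_value_nonneg: "p \<ge> 1 \<Longrightarrow> 0 \<le> sF_value p s"
  by (auto simp: sF_value_def split: enat.split)

lemma le_s_F:
  assumes "separates_frobenius_jets n X A Z e" "e \<ge> 1"
  shows "enat e \<le> s_F n X A Z"
  unfolding s_F_def by (rule Sup_upper) (use assms in blast)

lemma s_F_attained:
  assumes "s_F n X A Z = enat e" "e \<ge> 1"
  shows "separates_frobenius_jets n X A Z e"
proof -
  define E where "E = {enat e | e. e \<ge> 1 \<and> separates_frobenius_jets n X A Z e}"
  have S: "Sup E = enat e" using assms(1) by (simp add: s_F_def E_def)
  have "E \<noteq> {}" using S assms(2) by (auto simp: Sup_enat_def zero_enat_def)
  moreover have "finite E" using S by (auto simp: Sup_enat_def split: if_splits)
  ultimately have "enat e \<in> E" using S Max_in by (metis Sup_enat_def)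
  then show ?thesis by (auto simp: E_def)
qed

lemma s_F_infinite:
  assumes "s_F n X A Z = \<infinity>"
  shows "infinite {e. e \<ge> 1 \<and> separates_frobenius_jets n X A Z e}"
proof
  assume "finite {e. e \<ge> 1 \<and> separates_frobenius_jets n X A Z e}"
  then have "finite (enat ` {e. e \<ge> 1 \<and> separates_frobenius_jets n X A Z e})" by simp
  also have "enat ` {e. e \<ge> 1 \<and> separates_frobenius_jets n X A Z e} =
      {enat e | e. e \<ge> 1 \<and> separates_frobenius_jets n X A Z e}" by blast
  finally show False using assms Max_in
    by (fastforce simp: s_F_def Sup_enat_def split: if_splits)
qed

lemma s_F_eq_infinity:
  assumes "infinite {e. e \<ge> 1 \<and> separates_frobenius_jets n X A Z e}"
  shows "s_F n X A Z = \<infinity>"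
proof (rule ccontr)
  assume "s_F n X A Z \<noteq> \<infinity>"
  then obtain k where "s_F n X A Z = enat k" by blast
  then have "{e. e \<ge> 1 \<and> separates_frobenius_jets n X A Z e} \<subseteq> {..k}"
    using le_s_F[of n X A Z] by fastforce
  with assms show False using finite_subset by blast
qed

lemma ex_add_dvd:
  fixes d r :: nat assumes "r \<ge> 1"
  obtains j where "j < r" "r dvd d + j"
proof
  show "(r - d mod r) mod r < r" using assms by simp
  have "d + (r - d mod r) = r * (d div r) + r"
    using mod_less_divisor[of r d] mult_div_mod_eq[of r d] assms by linarith
  then have "r dvd d + (r - d mod r)" by simp
  then show "r dvd d + (r - d mod r) mod r" by (simp add: mod_add_right_eq dvd_eq_mod_eq_0)
qed

lemma geometric_ratio_tendsto:
  fixes d :: "nat \<Rightarrow> real"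
  assumes "\<And>k. d k \<ge> real k" "r \<ge> 0"
  shows "(\<lambda>k. c * (d k / (d k + r))) \<longlonglongrightarrow> c"
proof -
  have lim: "filterlim (\<lambda>k. d k + r) at_top sequentially"
  proof (rule filterlim_at_top_mono[OF filterlim_real_sequentially])
    show "\<forall>\<^sub>F k in sequentially. real k \<le> d k + r"
      using assms by (intro always_eventually allI add_increasing2) auto
  qed
  have "(\<lambda>k. c * (1 - r / (d k + r))) \<longlonglongrightarrow> c * (1 - 0)"
    by (intro tendsto_intros real_tendsto_divide_at_top[OF tendsto_const lim])
  moreover have "\<forall>\<^sub>F k in sequentially. c * (1 - r / (d k + r)) = c * (d k / (d k + r))"
    using eventually_gt_at_top[of 0]
  proof eventually_elim
    case (elim k)
    then have "d k + r > 0" using assms(1)[of k] assms(2) by linarith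
    then show ?case by (simp add: field_simps)
  qed
  ultimately show ?thesis by (simp add: tendsto_cong)
qed

text \<open>
  Each term of the supremum defining \<open>\<epsilon>\<^sub>F(L; Z)\<close>, multiplied by \<open>r\<close>, is bounded by \<open>\<epsilon>\<^sub>F(L\<^sup>r; Z)\<close>.
  When \<open>s\<^sub>F\<close> is infinite no limit is needed: \<open>L\<^bsup>r m\<^esup>\<close> separates all jets that \<open>L\<^sup>m\<close> separates.
\<close>
lemma (in jet_data) eps_F_term_le:
  assumes r: "r \<ge> 1" and m: "m \<ge> 1"
  shows "ereal (real r) * (sF_value CHAR('a) (s_F n X (tensor_power L m) Z) / ereal (real m))
    \<le> eps_F n X (tensor_power L r) Z"
proof -
  let ?p = "CHAR('a)" and ?E = "eps_F n X (tensor_power L r) Z"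
  have p1: "?p \<ge> 1" using char_pos by simp
  have upper: "sF_value ?p (s_F n X (tensor_power L (r * c)) Z) / ereal (real c) \<le> ?E"
    if "c \<ge> 1" for c
    unfolding eps_F_alt tensor_power_tensor_power by (rule SUP_upper) (use that in auto)
  show ?thesis
  proof (cases "s_F n X (tensor_power L m) Z")
    case infinity
    have "sep (r * m) e" if e: "sep m e" for e
    proof -
      obtain u where u: "u \<in> sect m" "\<And>P. P \<in> Z \<Longrightarrow> at_pt u P P = 1"
        by (rule sep_unit_section[OF e]) (rule that)
      have "sep (m + (r - 1) * m) e"
        by (rule sep_add_unit_multiple[OF e u(1)]) (simp add: u(2))
      also have "m + (r - 1) * m = r * m" using r by (cases r) auto
      finally show ?thesis .
    qed
    then have "{e. e \<ge> 1 \<and> sep m e} \<subseteq> {e. e \<ge> 1 \<and> sep (r * m) e}" by blast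
    then have "s_F n X (tensor_power L (r * m)) Z = \<infinity>"
      using s_F_infinite[OF infinity] by (intro s_F_eq_infinity) (rule infinite_super)
    then have "?E = \<infinity>" using upper[OF m] m by (simp add: sF_value_def)
    then show ?thesis by simp
  next
    case (enat e)
    show ?thesis
    proof (cases "e = 0")
      case True
      have "0 \<le> sF_value ?p (s_F n X (tensor_power L (r * 1)) Z) / ereal (real 1)"
        using sF_value_nonneg[OF p1] by simp
      also have "\<dots> \<le> ?E" by (rule upper) simp
      finally show ?thesis using True enat by (simp add: sF_value_def zero_ereal_def[symmetric])
    next
      case False
      then have e: "sep m e" using s_F_attained[OF enat] by simp
      obtain u where u: "u \<in> sect m" "\<And>P. P \<in> Z \<Longrightarrow> at_pt u P P = 1"
        by (rule sep_unit_section[OF e]) (rule that)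
      define D where "D k = (\<Sum>i\<le>k. ?p ^ (e * i))" for k
      have D_geo: "real (D k) * (real ?p ^ e - 1) = real ?p ^ (e * Suc k) - 1" for k
      proof -
        have "real (D k) = (\<Sum>i\<le>k. (real ?p ^ e) ^ i)" by (simp add: D_def power_mult)
        then show ?thesis
          using power_diff_1_eq[of "real ?p ^ e" "Suc k"]
          by (simp only: lessThan_Suc_atMost power_mult mult.commute)
      qed
      have D_ge: "real (D k) \<ge> real k" for k
      proof -
        have "(\<Sum>i\<le>k. 1) \<le> D k" unfolding D_def using p1 by (intro sum_mono) simp
        then show ?thesis by simp
      qed
      have bound: "ereal (real r * (real ?p ^ e - 1) / real m * (real (D k) / (real (D k) + real r))) \<le> ?E"
        for k
      proof -
        \<comment> \<open>Bounded padding makes the exponent divisible by \<open>r\<close>, also when \<open>p\<close> divides \<open>r\<close>.\<close>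
        obtain j where j: "j < r" "r dvd D k + j" using ex_add_dvd[OF r] by blast
        then obtain c where c: "D k + j = r * c" by blast
        have Dpos: "D k > 0"
        proof -
          have "?p ^ (e * 0) \<le> D k" unfolding D_def by (rule member_le_sum) auto
          then show ?thesis by simp
        qed
        with c have c1: "c \<ge> 1" by (cases c) auto
        have "sep (m * D k + j * m) (e * Suc k)"
          unfolding D_def
          by (rule sep_add_unit_multiple[OF sep_iterate[OF e] u(1)]) (simp_all add: u(2))
        also have "m * D k + j * m = m * (D k + j)" by (simp add: algebra_simps)
        also have "\<dots> = r * (m * c)" unfolding c by (simp add: mult_ac)
        finally have "enat (e * Suc k) \<le> s_F n X (tensor_power L (r * (m * c))) Z"
          using False by (intro le_s_F) auto
        then have "sF_value ?p (enat (e * Suc k)) \<le> sF_value ?p (s_F n X (tensor_power L (r * (m * c))) Z)"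
          by (rule sF_value_mono[OF p1])
        then have "sF_value ?p (enat (e * Suc k)) / ereal (real (m * c)) \<le>
            sF_value ?p (s_F n X (tensor_power L (r * (m * c))) Z) / ereal (real (m * c))"
          by (rule ereal_divide_right_mono) (use m c1 in auto)
        also have "\<dots> \<le> ?E" by (rule upper) (use m c1 in auto)
        finally have 1: "ereal ((real ?p ^ (e * Suc k) - 1) / real (m * c)) \<le> ?E"
          using m c1 by (simp add: sF_value_def split: if_splits)
        have rc: "real r * real c = real (D k) + real j" using c by (metis of_nat_add of_nat_mult)
        have "real r * (real ?p ^ e - 1) / real m * (real (D k) / (real (D k) + real r)) =
            real r * ((real ?p ^ (e * Suc k) - 1) / (real m * (real (D k) + real r)))"
          unfolding D_geo[symmetric] by simp
        also have "\<dots> \<le> real r * ((real ?p ^ (e * Suc k) - 1) / (real m * (real r * real c)))"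
          unfolding rc using j(1) m Dpos p1
          by (intro mult_left_mono divide_left_mono mult_pos_pos) auto
        also have "\<dots> = (real ?p ^ (e * Suc k) - 1) / real (m * c)" using r by simp
        finally show ?thesis using 1 ereal_less_eq(3) order_trans by blast
      qed
      have "(\<lambda>k. ereal (real r * (real ?p ^ e - 1) / real m * (real (D k) / (real (D k) + real r))))
          \<longlonglongrightarrow> ereal (real r * (real ?p ^ e - 1) / real m)"
        unfolding lim_ereal by (rule geometric_ratio_tendsto[OF D_ge]) simp
      then have "ereal (real r * (real ?p ^ e - 1) / real m) \<le> ?E"
        by (rule LIMSEQ_le_const2) (use bound in blast)
      then show ?thesis using enat m by (simp add: sF_value_def)
    qed
  qed
qed

theorem proposition2p8:
  fixes X Z :: "'a::alg_closed_field pt set" and L :: "('i, 'a) lbundle" and n p r :: nat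
  assumes "CHAR('a) = p" and "p > 0"
    and "projective_variety n X"
    and "line_bundle n X L" and "ample n X L"
    and "finite Z" and "\<forall>P\<in>Z. smooth_point n X P"
    and "r \<ge> 1"
  shows "eps_F n X (tensor_power L r) Z = ereal (real r) * eps_F n X L Z"
proof (rule antisym)
  have X: "X \<subseteq> proj_space n"
    using assms(3) closedin_subset[of "zariski n" X]
    by (simp add: projective_variety_def irreducible_closedin_def topspace_zariski)
  interpret jet_data n X Z L
    by unfold_locales (use X assms in \<open>auto simp: smooth_point_def\<close>)
  have p1: "CHAR('a) \<ge> 1" using char_pos by simp
  let ?v = "\<lambda>m. sF_value CHAR('a) (s_F n X (tensor_power L m) Z)"
  have r0: "ereal (real r) > 0" using assms(8) by simp
  show "eps_F n X (tensor_power L r) Z \<le> ereal (real r) * eps_F n X L Z"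
    unfolding eps_F_alt[of n X "tensor_power L r"] tensor_power_tensor_power
  proof (rule SUP_least)
    fix m :: nat assume m: "m \<in> {1..}"
    have "?v (r * m) / ereal (real m) = ereal (real r) * (?v (r * m) / ereal (real (r * m)))"
      using m assms(8) by (cases "?v (r * m)") auto
    also have "\<dots> \<le> ereal (real r) * eps_F n X L Z"
      unfolding eps_F_alt using m assms(8)
      by (intro ereal_mult_left_mono SUP_upper) auto
    finally show "?v (r * m) / ereal (real m) \<le> ereal (real r) * eps_F n X L Z" .
  qed
  have "ereal (real r) * eps_F n X L Z = (SUP m\<in>{1..}. ereal (real r) * (?v m / ereal (real m)))"
    unfolding eps_F_alt[of n X L]
    by (rule SUP_ereal_mult_left[symmetric]) (use sF_value_nonneg[OF p1] in auto)
  also have "\<dots> \<le> eps_F n X (tensor_power L r) Z"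
    by (rule SUP_least, rule eps_F_term_le) (use assms(8) in auto)
  finally show "ereal (real r) * eps_F n X L Z \<le> eps_F n X (tensor_power L r) Z" .
qed

end
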